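(* Let $S$ be an operator on $L^2(\mathbb{R}^d)$ and $F$ a tempered distribution on $\mathbb{R}^{2d}$ such that the mixed-state localization operator $F\star S$ is compact. Let $\{\psi_n\}_{n\in\mathbb{N}_0^d}$ be a collection of functions in $L^2(\mathbb{R}^d)$. Then $\{\psi_n\}_{n\in\mathbb{N}_0^d}$ are the eigenfunctions of $F\star S$ if and only if the following two conditions are satisfied: (1) $\{\psi_n\}_{n\in\mathbb{N}_0^d}$ is an orthonormal basis of $L^2(\mathbb{R}^d)$; and (2) $\displaystyle\int_{\mathbb{R}^{2d}}F(z)\,Q_S(\psi_n,\psi_m)(z)\,dz=c_n\delta_{n,m}$ (for $n,m\in\mathbb{N}_0^d$, with some numbers $c_n$). In this case, the $n$-th eigenvalue is $c_n$. (Conditions (1) and (2) are called the quantum double orthogonality conditions.)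
   Context: For $z=(x,\omega)\in\mathbb{R}^{2d}$, $\pi(z)g(t)=e^{2\pi i\langle t,\omega\rangle}g(t-x)$, and $\alpha_z(S)=\pi(z)S\pi(z)^*$. The function-operator convolution (mixed-state localization operator) is $F\star S=\int_{\mathbb{R}^{2d}}F(z)\alpha_z(S)\,dz$, interpreted weakly. The cross-Cohen's class distribution of $S$ is $Q_S(f,g)=(f\otimes g)\star\check S$, where $(f\otimes g)h=\langle h,g\rangle f$, $\check S=PSP$ with $Pf(t)=f(-t)$, and $A\star B(z)=\mathrm{tr}(A\alpha_z(\check B))$; thus $Q_S(f,g)(z)=\mathrm{tr}\bigl((f\otimes g)\alpha_z(S)\bigr)=\langle\alpha_z(S)f,g\rangle$. When $F$ is a distribution, $\int F(z)\langle\alpha_z(S)f,g\rangle\,dz$ denotes the duality pairing that weakly defines $\langle(F\star S)f,g\rangle$. Inner products are antilinear in the second slot.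
   Formalization: "Are the eigenfunctions of F⋆S" is read spectrally: the ψ_n are orthonormal, F⋆S is the sum of c_n ψ_n⊗ψ_n, and every eigenfunction lies in their closed span; merely being eigenfunctions would not suffice (rescaling, non-normal F⋆S). *)

theory Defs
  imports "HOL-Analysis.Analysis"
begin

section \<open>The complex Hilbert space of square-integrable functions\<close>

definition square_integrable :: "('a::euclidean_space \<Rightarrow> complex) \<Rightarrow> bool" where
  "square_integrable f \<longleftrightarrow>
     f \<in> borel_measurable borel \<and> integrable lborel (\<lambda>t. (cmod (f t))\<^sup>2)"

lemma square_integrable_mult_cnj:
  assumes "square_integrable f" "square_integrable g"
  shows "integrable lborel (\<lambda>t. f t * cnj (g t))"
proof (rule Bochner_Integration.integrable_bound)
  show "integrable lborel (\<lambda>t. (cmod (f t))\<^sup>2 + (cmod (g t))\<^sup>2)"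
    using assms by (simp add: square_integrable_def)
  show "(\<lambda>t. f t * cnj (g t)) \<in> borel_measurable lborel"
  proof -
    have [measurable]: "f \<in> borel_measurable borel" "g \<in> borel_measurable borel"
      using assms by (simp_all add: square_integrable_def)
    have [measurable]: "cnj \<in> borel_measurable borel"
      by (intro borel_measurable_continuous_onI continuous_on_cnj continuous_on_id)
    show ?thesis by measurable
  qed
  have "cmod (f t) * cmod (g t) \<le> (cmod (f t))\<^sup>2 + (cmod (g t))\<^sup>2" for t
  proof -
    have "0 \<le> (cmod (f t) - cmod (g t))\<^sup>2" "0 \<le> (cmod (f t))\<^sup>2" "0 \<le> (cmod (g t))\<^sup>2" by simp_all
    then show ?thesis unfolding power2_diff by linarith
  qed
  then show "AE t in lborel. norm (f t * cnj (g t)) \<le> norm ((cmod (f t))\<^sup>2 + (cmod (g t))\<^sup>2)"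
    by (simp add: norm_mult)
qed

lemma square_integrable_add:
  assumes "square_integrable f" "square_integrable g"
  shows "square_integrable (\<lambda>t. f t + g t)"
  unfolding square_integrable_def
proof (intro conjI)
  show m: "(\<lambda>t. f t + g t) \<in> borel_measurable borel"
    using assms by (auto simp: square_integrable_def)
  show "integrable lborel (\<lambda>t. (cmod (f t + g t))\<^sup>2)"
  proof (rule Bochner_Integration.integrable_bound)
    show "integrable lborel (\<lambda>t. 2 * (cmod (f t))\<^sup>2 + 2 * (cmod (g t))\<^sup>2)"
      using assms by (simp add: square_integrable_def)
    show "(\<lambda>t. (cmod (f t + g t))\<^sup>2) \<in> borel_measurable lborel"
      using m by simp
    have "(cmod (f t + g t))\<^sup>2 \<le> 2 * (cmod (f t))\<^sup>2 + 2 * (cmod (g t))\<^sup>2" for t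
    proof -
      have "(cmod (f t + g t))\<^sup>2 \<le> (cmod (f t) + cmod (g t))\<^sup>2"
        by (simp add: norm_triangle_ineq power_mono)
      moreover have "0 \<le> (cmod (f t) - cmod (g t))\<^sup>2" by simp
      ultimately show ?thesis unfolding power2_sum power2_diff by linarith
    qed
    then show "AE t in lborel. norm ((cmod (f t + g t))\<^sup>2)
        \<le> norm (2 * (cmod (f t))\<^sup>2 + 2 * (cmod (g t))\<^sup>2)"
      by simp
  qed
qed

lemma square_integrable_scale:
  "square_integrable f \<Longrightarrow> square_integrable (\<lambda>t. c * f t)"
  by (auto simp: square_integrable_def norm_mult power_mult_distrib)

lemma square_integrable_zero: "square_integrable (\<lambda>_. 0)"
  by (simp add: square_integrable_def)

definition L2_rel :: "('a::euclidean_space \<Rightarrow> complex) \<Rightarrow> ('a \<Rightarrow> complex) \<Rightarrow> bool" where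
  "L2_rel f g \<longleftrightarrow> square_integrable f \<and> square_integrable g \<and> (AE t in lborel. f t = g t)"

lemma L2_rel_part_equivp:
  "part_equivp (L2_rel :: ('a::euclidean_space \<Rightarrow> complex) \<Rightarrow> _)"
proof (rule part_equivpI)
  show "\<exists>f :: 'a \<Rightarrow> complex. L2_rel f f"
    by (intro exI[of _ "\<lambda>_. 0"]) (simp add: L2_rel_def square_integrable_zero)
  show "symp (L2_rel :: ('a \<Rightarrow> complex) \<Rightarrow> _)"
    unfolding L2_rel_def by (intro sympI) (simp add: eq_commute)
  show "transp (L2_rel :: ('a \<Rightarrow> complex) \<Rightarrow> _)"
  proof (rule transpI)
    fix f g h :: "'a \<Rightarrow> complex"
    assume r: "L2_rel f g" "L2_rel g h"
    then have "AE t in lborel. f t = g t" "AE t in lborel. g t = h t"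
      by (simp_all add: L2_rel_def)
    then have "AE t in lborel. f t = h t"
      by eventually_elim simp
    with r show "L2_rel f h"
      by (simp add: L2_rel_def)
  qed
qed

quotient_type (overloaded) 'a L2 = "'a::euclidean_space \<Rightarrow> complex" / partial: L2_rel
  by (rule L2_rel_part_equivp)

lift_definition cinner :: "'a::euclidean_space L2 \<Rightarrow> 'a L2 \<Rightarrow> complex"
  is "\<lambda>f g. LINT t|lborel. f t * cnj (g t)"
proof -
  fix f f' g g' :: "'a \<Rightarrow> complex"
  assume r: "L2_rel f f'" "L2_rel g g'"
  have i: "integrable lborel (\<lambda>t. f t * cnj (g t))" "integrable lborel (\<lambda>t. f' t * cnj (g' t))"
    using r by (simp_all add: L2_rel_def square_integrable_mult_cnj)
  have "AE t in lborel. f t = f' t" "AE t in lborel. g t = g' t"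
    using r by (simp_all add: L2_rel_def)
  then have "AE t in lborel. f t * cnj (g t) = f' t * cnj (g' t)"
    by eventually_elim simp
  then show "(LINT t|lborel. f t * cnj (g t)) = (LINT t|lborel. f' t * cnj (g' t))"
    by (intro integral_cong_AE borel_measurable_integrable[OF i(1)] borel_measurable_integrable[OF i(2)])
qed

lift_definition scaleC :: "complex \<Rightarrow> 'a::euclidean_space L2 \<Rightarrow> 'a L2" (infixr "*\<^sub>C" 75)
  is "\<lambda>c f t. c * f t"
proof -
  fix c :: complex and f g :: "'a \<Rightarrow> complex"
  assume r: "L2_rel f g"
  then have "AE t in lborel. f t = g t"
    by (simp add: L2_rel_def)
  then have "AE t in lborel. c * f t = c * g t"
    by eventually_elim simp
  with r show "L2_rel (\<lambda>t. c * f t) (\<lambda>t. c * g t)"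
    by (simp add: L2_rel_def square_integrable_scale)
qed

instantiation L2 :: (euclidean_space) real_inner
begin

lift_definition zero_L2 :: "'a L2" is "\<lambda>_. 0"
  by (simp add: L2_rel_def square_integrable_zero)

lift_definition plus_L2 :: "'a L2 \<Rightarrow> 'a L2 \<Rightarrow> 'a L2" is "\<lambda>f g t. f t + g t"
proof -
  fix f f' g g' :: "'a \<Rightarrow> complex"
  assume r: "L2_rel f f'" "L2_rel g g'"
  then have "AE t in lborel. f t = f' t" "AE t in lborel. g t = g' t"
    by (simp_all add: L2_rel_def)
  then have "AE t in lborel. f t + g t = f' t + g' t"
    by eventually_elim simp
  with r show "L2_rel (\<lambda>t. f t + g t) (\<lambda>t. f' t + g' t)"
    by (simp add: L2_rel_def square_integrable_add)
qed

definition uminus_L2 :: "'a L2 \<Rightarrow> 'a L2" where "- f = (-1) *\<^sub>C f"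

definition minus_L2 :: "'a L2 \<Rightarrow> 'a L2 \<Rightarrow> 'a L2" where "f - g = f + (- g)" for f g :: "'a L2"

definition scaleR_L2 :: "real \<Rightarrow> 'a L2 \<Rightarrow> 'a L2" where "r *\<^sub>R f = complex_of_real r *\<^sub>C f"

definition inner_L2 :: "'a L2 \<Rightarrow> 'a L2 \<Rightarrow> real" where "f \<bullet> g = Re (cinner f g)"

definition norm_L2 :: "'a L2 \<Rightarrow> real" where "norm f = sqrt (f \<bullet> f)" for f :: "'a L2"

definition dist_L2 :: "'a L2 \<Rightarrow> 'a L2 \<Rightarrow> real" where "dist f g = norm (f - g)" for f g :: "'a L2"

definition sgn_L2 :: "'a L2 \<Rightarrow> 'a L2" where "sgn f = inverse (norm f) *\<^sub>R f" for f :: "'a L2"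

definition uniformity_L2 :: "('a L2 \<times> 'a L2) filter" where
  "uniformity_L2 = (INF e\<in>{0<..}. principal {(f, g). dist f g < e})"

definition open_L2 :: "'a L2 set \<Rightarrow> bool" where
  "open_L2 U \<longleftrightarrow> (\<forall>f\<in>U. \<forall>\<^sub>F (f', g) in uniformity. f' = f \<longrightarrow> g \<in> U)"

instance
proof
  fix f g h :: "'a L2" and a b :: real
  show "f + g + h = f + (g + h)"
    by transfer (auto simp: L2_rel_def add.assoc intro!: square_integrable_add)
  show "f + g = g + f"
    by transfer (auto simp: L2_rel_def add.commute intro!: square_integrable_add)
  show "0 + f = f"
    by transfer (auto simp: L2_rel_def)
  show "- f + f = 0" unfolding uminus_L2_def
    by transfer (auto simp: L2_rel_def intro!: square_integrable_zero square_integrable_add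
        square_integrable_scale[where c="-1", simplified])
  show "f - g = f + - g" by (simp add: minus_L2_def)
  show "a *\<^sub>R (f + g) = a *\<^sub>R f + a *\<^sub>R g" unfolding scaleR_L2_def
    by transfer (auto simp: L2_rel_def distrib_left intro!: square_integrable_add square_integrable_scale)
  show "(a + b) *\<^sub>R f = a *\<^sub>R f + b *\<^sub>R f" unfolding scaleR_L2_def
    by transfer (auto simp: L2_rel_def distrib_right intro!: square_integrable_add square_integrable_scale)
  show "a *\<^sub>R b *\<^sub>R f = (a * b) *\<^sub>R f" unfolding scaleR_L2_def
    by transfer (auto simp: L2_rel_def mult.assoc intro!: square_integrable_scale)
  show "1 *\<^sub>R f = f" unfolding scaleR_L2_def
    by transfer (auto simp: L2_rel_def)
  show "f \<bullet> g = g \<bullet> f" unfolding inner_L2_def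
  proof transfer
    fix f g :: "'a \<Rightarrow> complex"
    assume "L2_rel f f" "L2_rel g g"
    have "(\<lambda>t. f t * cnj (g t)) = (\<lambda>t. cnj (g t * cnj (f t)))"
      by (simp add: mult.commute)
    then have "(LINT t|lborel. f t * cnj (g t)) = cnj (LINT t|lborel. g t * cnj (f t))"
      by (simp only: Bochner_Integration.integral_cnj)
    then show "Re (LINT t|lborel. f t * cnj (g t)) = Re (LINT t|lborel. g t * cnj (f t))"
      by simp
  qed
  show "(f + g) \<bullet> h = f \<bullet> h + g \<bullet> h" unfolding inner_L2_def
    by transfer (simp add: L2_rel_def distrib_right square_integrable_mult_cnj)
  show "(a *\<^sub>R f) \<bullet> g = a * (f \<bullet> g)" unfolding inner_L2_def scaleR_L2_def
    by transfer (simp add: mult.assoc)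
  have ff: "Re (LINT t|lborel. u t * cnj (u t)) = (LINT t|lborel. (cmod (u t))\<^sup>2)" for u :: "'a \<Rightarrow> complex"
    by (simp add: complex_norm_square [symmetric] flip: of_real_power)
  show "0 \<le> f \<bullet> f" unfolding inner_L2_def
    by transfer (simp add: ff)
  show "f \<bullet> f = 0 \<longleftrightarrow> f = 0" unfolding inner_L2_def
    by transfer (auto simp: ff L2_rel_def square_integrable_def integral_nonneg_eq_0_iff_AE)
  show "norm f = sqrt (f \<bullet> f)" by (simp add: norm_L2_def)
  show "dist f g = norm (f - g)" by (simp add: dist_L2_def)
  show "sgn f = inverse (norm f) *\<^sub>R f" by (simp add: sgn_L2_def)
  show "uniformity = (INF e\<in>{0<..}. principal {(f, g). dist f (g :: 'a L2) < e})"
    by (simp add: uniformity_L2_def)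
  show "open U = (\<forall>f\<in>U. \<forall>\<^sub>F (f', g) in uniformity. f' = f \<longrightarrow> g \<in> U)" for U :: "'a L2 set"
    by (simp add: open_L2_def)
qed

end

lemma scaleC_add_right: "c *\<^sub>C (f + g) = c *\<^sub>C f + c *\<^sub>C g"
  by transfer (auto simp: L2_rel_def distrib_left intro!: square_integrable_add square_integrable_scale)

lemma scaleC_add_left: "(b + c) *\<^sub>C f = b *\<^sub>C f + c *\<^sub>C f"
  by transfer (auto simp: L2_rel_def distrib_right intro!: square_integrable_add square_integrable_scale)

lemma scaleC_scaleC: "b *\<^sub>C c *\<^sub>C f = (b * c) *\<^sub>C f"
  by transfer (auto simp: L2_rel_def mult.assoc intro!: square_integrable_scale)

lemma scaleC_one: "1 *\<^sub>C f = f"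
  by transfer (auto simp: L2_rel_def)

global_interpretation L2: vector_space "scaleC :: complex \<Rightarrow> 'a::euclidean_space L2 \<Rightarrow> 'a L2"
  defines cspan = L2.span
  by unfold_locales (simp_all add: scaleC_add_right scaleC_add_left scaleC_scaleC scaleC_one)


section \<open>Operators, orthonormal systems and the trace\<close>

definition bounded_clinear :: "('a::euclidean_space L2 \<Rightarrow> 'a L2) \<Rightarrow> bool" where
  "bounded_clinear A \<longleftrightarrow> bounded_linear A \<and> (\<forall>c f. A (c *\<^sub>C f) = c *\<^sub>C A f)"

definition compact_operator :: "('a::euclidean_space L2 \<Rightarrow> 'a L2) \<Rightarrow> bool" where
  "compact_operator A \<longleftrightarrow> bounded_clinear A \<and> compact (closure (A ` cball 0 1))"

definition hadjoint :: "('a::euclidean_space L2 \<Rightarrow> 'a L2) \<Rightarrow> 'a L2 \<Rightarrow> 'a L2" where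
  "hadjoint A = (THE B. \<forall>f g. cinner (A f) g = cinner f (B g))"

definition orthonormal_system :: "'i set \<Rightarrow> ('i \<Rightarrow> 'a::euclidean_space L2) \<Rightarrow> bool" where
  "orthonormal_system I e \<longleftrightarrow>
     (\<forall>i\<in>I. \<forall>j\<in>I. cinner (e i) (e j) = (if i = j then 1 else 0))"

definition orthonormal_basis :: "'i set \<Rightarrow> ('i \<Rightarrow> 'a::euclidean_space L2) \<Rightarrow> bool" where
  "orthonormal_basis I e \<longleftrightarrow> orthonormal_system I e \<and> closure (cspan (e ` I)) = UNIV"

text \<open>The number \<open>\<Sum>e\<in>B. \<langle>A e, e\<rangle>\<close>, which for trace class \<open>A\<close> is the same for all
  orthonormal bases \<open>B\<close>; unspecified if there is no such common value.\<close>

definition trace_op :: "('a::euclidean_space L2 \<Rightarrow> 'a L2) \<Rightarrow> complex" where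
  "trace_op A =
     (THE t. \<forall>B. orthonormal_basis B (\<lambda>e. e) \<longrightarrow> ((\<lambda>e. cinner (A e) e) has_sum t) B)"

definition rank_one :: "'a::euclidean_space L2 \<Rightarrow> 'a L2 \<Rightarrow> 'a L2 \<Rightarrow> 'a L2" where
  "rank_one f g h = cinner h g *\<^sub>C f"

text \<open>``\<open>\<psi>\<close> are the eigenfunctions of \<open>T\<close>, with eigenvalues \<open>\<mu>\<close>'' is meant in the sense of the
  spectral theorem for compact operators. Eigenfunctions are normalised and chosen orthogonal,
  they diagonalise \<open>T\<close>, i.e. \<open>T = \<Sum>n. \<mu>\<^sub>n \<psi>\<^sub>n \<otimes> \<psi>\<^sub>n\<close>, and none is missing: every
  eigenfunction of \<open>T\<close>, for whatever eigenvalue (zero included), is a limit of linear combinations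
  of them. A repeated value of \<open>\<mu>\<close> accounts for multiplicity. Merely asking for
  \<open>T \<psi>\<^sub>n = \<mu>\<^sub>n \<psi>\<^sub>n\<close> would not do, as rescaling or repeating eigenfunctions
  destroys orthonormality, and a non-normal \<open>T\<close> has no orthonormal basis of eigenfunctions.\<close>

definition eigenfunctions :: "('a::euclidean_space L2 \<Rightarrow> 'a L2) \<Rightarrow> ('i \<Rightarrow> 'a L2) \<Rightarrow> ('i \<Rightarrow> complex) \<Rightarrow> bool"
  where
  "eigenfunctions T \<psi> \<mu> \<longleftrightarrow>
     orthonormal_system UNIV \<psi> \<and>
     (\<forall>n. T (\<psi> n) = \<mu> n *\<^sub>C \<psi> n) \<and>
     (\<forall>f. ((\<lambda>n. \<mu> n *\<^sub>C rank_one (\<psi> n) (\<psi> n) f) has_sum T f) UNIV) \<and>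
     (\<forall>c f. T f = c *\<^sub>C f \<longrightarrow> f \<in> closure (cspan (range \<psi>)))"


section \<open>Time-frequency shifts and operator convolutions\<close>

lemma L2_rel_unimodular_comp:
  fixes f g u :: "'a::euclidean_space \<Rightarrow> complex" and h :: "'a \<Rightarrow> 'a"
  assumes "L2_rel f g" and u: "u \<in> borel_measurable borel" "\<And>t. cmod (u t) = 1"
    and h: "h \<in> borel_measurable borel" "distr lborel borel h = lborel"
  shows "L2_rel (\<lambda>t. u t * f (h t)) (\<lambda>t. u t * g (h t))"
proof -
  have *: "square_integrable (\<lambda>t. u t * k (h t))" if "square_integrable k" for k
  proof -
    have k: "k \<in> borel_measurable borel" "integrable lborel (\<lambda>t. (cmod (k t))\<^sup>2)"
      using that by (auto simp: square_integrable_def)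
    have "integrable (distr lborel borel h) (\<lambda>t. (cmod (k t))\<^sup>2)"
      using k h by simp
    then have "integrable lborel (\<lambda>t. (cmod (k (h t)))\<^sup>2)"
      using k h by (subst (asm) integrable_distr_eq) auto
    then show ?thesis
      using k h u by (auto simp: square_integrable_def norm_mult)
  qed
  have fg: "square_integrable f" "square_integrable g" "AE t in lborel. f t = g t"
    using assms by (auto simp: L2_rel_def)
  have [measurable]: "f \<in> borel_measurable borel" "g \<in> borel_measurable borel"
    using fg by (auto simp: square_integrable_def)
  have "AE t in distr lborel borel h. f t = g t"
    unfolding h(2) by (rule fg(3))
  then have "AE t in lborel. f (h t) = g (h t)"
    using h(1) by (subst (asm) AE_distr_iff) auto
  then have "AE t in lborel. u t * f (h t) = u t * g (h t)"
    by eventually_elim simp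
  then show ?thesis
    using fg * by (simp add: L2_rel_def)
qed

text \<open>A phase space point is \<open>z = (x, \<omega>)\<close>.\<close>

lift_definition tf_shift :: "'a::euclidean_space \<times> 'a \<Rightarrow> 'a L2 \<Rightarrow> 'a L2"
  is "\<lambda>z g t. exp (2 * of_real pi * \<i> * of_real (t \<bullet> snd z)) * g (t - fst z)"
proof -
  fix z :: "'a \<times> 'a" and f g :: "'a \<Rightarrow> complex"
  assume "L2_rel f g"
  moreover have "distr lborel borel (\<lambda>t. t - fst z) = (lborel :: 'a measure)"
  proof -
    have "(\<lambda>t. t - fst z) = (+) (- fst z)"
      by (simp add: fun_eq_iff)
    then show ?thesis
      by (simp only: lborel_distr_plus)
  qed
  moreover have "(\<lambda>t. exp (2 * of_real pi * \<i> * of_real (t \<bullet> snd z))) \<in> borel_measurable borel"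
    by (intro borel_measurable_continuous_onI continuous_intros)
  ultimately show "L2_rel (\<lambda>t. exp (2 * of_real pi * \<i> * of_real (t \<bullet> snd z)) * f (t - fst z))
      (\<lambda>t. exp (2 * of_real pi * \<i> * of_real (t \<bullet> snd z)) * g (t - fst z))"
    by (intro L2_rel_unimodular_comp) auto
qed

lift_definition parity :: "'a::euclidean_space L2 \<Rightarrow> 'a L2" is "\<lambda>f t. f (- t)"
proof -
  fix f g :: "'a \<Rightarrow> complex"
  assume "L2_rel f g"
  moreover have "distr lborel borel uminus = (lborel :: 'a measure)"
    using lborel_affine[of "-1" "0 :: 'a"] by (simp add: density_1)
  ultimately show "L2_rel (\<lambda>t. f (- t)) (\<lambda>t. g (- t))"
    using L2_rel_unimodular_comp[of f g "\<lambda>_. 1" uminus] by simp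
qed

definition op_translate :: "'a::euclidean_space \<times> 'a \<Rightarrow> ('a L2 \<Rightarrow> 'a L2) \<Rightarrow> 'a L2 \<Rightarrow> 'a L2" where
  "op_translate z S = tf_shift z \<circ> S \<circ> hadjoint (tf_shift z)"

definition op_check :: "('a::euclidean_space L2 \<Rightarrow> 'a L2) \<Rightarrow> 'a L2 \<Rightarrow> 'a L2" where
  "op_check S = parity \<circ> S \<circ> parity"

definition op_convolution ::
  "('a::euclidean_space L2 \<Rightarrow> 'a L2) \<Rightarrow> ('a L2 \<Rightarrow> 'a L2) \<Rightarrow> 'a \<times> 'a \<Rightarrow> complex" where
  "op_convolution A B z = trace_op (A \<circ> op_translate z (op_check B))"

definition cohen_class ::
  "('a::euclidean_space L2 \<Rightarrow> 'a L2) \<Rightarrow> 'a L2 \<Rightarrow> 'a L2 \<Rightarrow> 'a \<times> 'a \<Rightarrow> complex" where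
  "cohen_class S f g = op_convolution (rank_one f g) (op_check S)"


section \<open>Schwartz functions and tempered distributions\<close>

primrec iterated_deriv :: "'b::euclidean_space list \<Rightarrow> ('b \<Rightarrow> complex) \<Rightarrow> 'b \<Rightarrow> complex" where
  "iterated_deriv [] \<phi> = \<phi>"
| "iterated_deriv (b # bs) \<phi> = (\<lambda>x. frechet_derivative (iterated_deriv bs \<phi>) (at x) b)"

definition schwartz :: "('b::euclidean_space \<Rightarrow> complex) \<Rightarrow> bool" where
  "schwartz \<phi> \<longleftrightarrow>
     (\<forall>bs \<in> lists Basis.
        (\<forall>x. iterated_deriv bs \<phi> differentiable at x) \<and>
        (\<forall>k::nat. bounded (range (\<lambda>x. norm x ^ k *\<^sub>R iterated_deriv bs \<phi> x))))"

definition schwartz_seminorm :: "nat \<Rightarrow> 'b::euclidean_space list \<Rightarrow> ('b \<Rightarrow> complex) \<Rightarrow> real" where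
  "schwartz_seminorm k bs \<phi> = (SUP x. norm x ^ k * cmod (iterated_deriv bs \<phi> x))"

text \<open>Continuity of the functional is expressed by the usual estimate by finitely many seminorms.
  The values of \<open>F\<close> outside the Schwartz space are irrelevant.\<close>

definition tempered_distribution :: "(('b::euclidean_space \<Rightarrow> complex) \<Rightarrow> complex) \<Rightarrow> bool" where
  "tempered_distribution F \<longleftrightarrow>
     (\<forall>\<phi> \<eta>. schwartz \<phi> \<longrightarrow> schwartz \<eta> \<longrightarrow> F (\<lambda>z. \<phi> z + \<eta> z) = F \<phi> + F \<eta>) \<and>
     (\<forall>c \<phi>. schwartz \<phi> \<longrightarrow> F (\<lambda>z. c * \<phi> z) = c * F \<phi>) \<and>
     (\<exists>C N. \<forall>\<phi>. schwartz \<phi> \<longrightarrow>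
        cmod (F \<phi>) \<le> C * (\<Sum>k\<le>N. \<Sum>bs | bs \<in> lists Basis \<and> length bs \<le> N. schwartz_seminorm k bs \<phi>))"

definition schwartz_L2 :: "'a::euclidean_space L2 set" where
  "schwartz_L2 = {f. \<exists>u. schwartz u \<and> (AE t in lborel. rep_L2 f t = u t)}"


section \<open>Mixed-state localization operators\<close>

text \<open>The duality pairing \<open>\<integral> F(z) \<phi>(z) dz\<close> is bilinear. It is \<open>F \<phi>\<close> for Schwartz functions
  \<open>\<phi>\<close>. For test functions \<open>f\<close>, \<open>g\<close> the function \<open>\<phi> = Q\<^sub>S(f, g)\<close> is smooth and bounded with all its
  derivatives, but it is a Schwartz function only for special \<open>S\<close>. The pairing is therefore
  taken as an oscillatory integral, i.e. as the limit when smooth cutoffs are removed. This is the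
  Lebesgue integral whenever \<open>F\<close> is a function and \<open>F \<phi>\<close> is integrable, e.g. for bounded \<open>F\<close> and
  trace class \<open>S\<close>.\<close>

definition has_pairing ::
  "(('b::euclidean_space \<Rightarrow> complex) \<Rightarrow> complex) \<Rightarrow> ('b \<Rightarrow> complex) \<Rightarrow> complex \<Rightarrow> bool" where
  "has_pairing F \<phi> v \<longleftrightarrow>
     (\<forall>\<eta>. schwartz \<eta> \<and> \<eta> 0 = 1 \<longrightarrow>
        ((\<lambda>\<epsilon>. F (\<lambda>z. \<eta> (\<epsilon> *\<^sub>R z) * \<phi> z)) \<longlongrightarrow> v) (at_right 0))"

definition pairing :: "(('b::euclidean_space \<Rightarrow> complex) \<Rightarrow> complex) \<Rightarrow> ('b \<Rightarrow> complex) \<Rightarrow> complex" where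
  "pairing F \<phi> = (THE v. has_pairing F \<phi> v)"

text \<open>\<open>F \<star> S = T\<close>, weakly: \<open>T\<close> is the bounded operator with
  \<open>\<langle>T f, g\<rangle> = \<integral> F(z) Q\<^sub>S(f, g)(z) dz\<close> for all test functions \<open>f\<close>, \<open>g\<close>. By density there is at most
  one such \<open>T\<close>.\<close>

definition is_localization_op ::
  "(('a::euclidean_space \<times> 'a \<Rightarrow> complex) \<Rightarrow> complex) \<Rightarrow> ('a L2 \<Rightarrow> 'a L2) \<Rightarrow> ('a L2 \<Rightarrow> 'a L2) \<Rightarrow> bool"
  where
  "is_localization_op F S T \<longleftrightarrow>
     bounded_clinear T \<and>
     (\<forall>f\<in>schwartz_L2. \<forall>g\<in>schwartz_L2. has_pairing F (cohen_class S f g) (cinner (T f) g))"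

text \<open>\<open>\<integral> F(z) Q\<^sub>S(f, g)(z) dz = v\<close> for arbitrary square-integrable \<open>f\<close>, \<open>g\<close>, where \<open>Q\<^sub>S(f, g)\<close> need
  not be smooth: the pairing is extended by continuity from test functions.\<close>

definition has_cohen_integral ::
  "(('a::euclidean_space \<times> 'a \<Rightarrow> complex) \<Rightarrow> complex) \<Rightarrow> ('a L2 \<Rightarrow> 'a L2) \<Rightarrow> 'a L2 \<Rightarrow> 'a L2 \<Rightarrow> complex \<Rightarrow> bool"
  where
  "has_cohen_integral F S f g v \<longleftrightarrow>
     ((\<lambda>(u, w). pairing F (cohen_class S u w)) \<longlongrightarrow> v) (at (f, g) within schwartz_L2 \<times> schwartz_L2)"

end

theory Submission
  imports Defs "HOL-Probability.Distributions"
begin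

text \<open>
  The quantum double orthogonality conditions say that \<open>T = F \<star> S\<close> has a diagonal matrix in the
  orthonormal basis \<open>\<psi>\<close>. For Schwartz functions \<open>u\<close> and \<open>w\<close> the pairing of \<open>F\<close> with \<open>Q\<^sub>S(u, w)\<close> is
  \<open>\<langle>T u, w\<rangle>\<close> by the definition of the localization operator. As \<open>T\<close> is continuous and the Schwartz functions
  are dense in \<open>L\<^sup>2\<close>, the extended integral of \<open>F Q\<^sub>S(f, g)\<close> exists for all \<open>f\<close> and \<open>g\<close> and equals \<open>\<langle>T f, g\<rangle>\<close>
  (\<open>has_cohen_integral_iff\<close>). So condition (2) reads \<open>\<langle>T \<psi>\<^sub>n, \<psi>\<^sub>m\<rangle> = c\<^sub>n \<delta>\<^sub>n\<^sub>m\<close>, and the numbers \<open>c\<^sub>n\<close> must be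
  the eigenvalues as soon as the \<open>\<psi>\<^sub>n\<close> are eigenfunctions.

  What remains is Hilbert space theory. A bounded operator with a diagonal matrix in an orthonormal basis has
  the basis vectors as eigenvectors, and applying it to the Fourier series of \<open>f\<close> gives its spectral
  expansion (\<open>eigenfunctions_of_diagonal_matrix\<close>). Conversely, let the \<open>\<psi>\<^sub>n\<close> be the eigenfunctions. The
  difference of \<open>f\<close> and its projection onto their closed span is annihilated by \<open>T\<close>, so it is itself an
  eigenfunction and belongs to the closed span: the \<open>\<psi>\<^sub>n\<close> form a basis
  (\<open>orthonormal_basis_of_eigenfunctions\<close>). The projection exists because \<open>L\<^sup>2\<close> is complete, which is the
  Riesz--Fischer theorem.

  The density of the Schwartz functions (\<open>closure_schwartz_L2\<close>) rests on the functions
  \<open>exp (- \<Sum>i. ((x\<^sub>i - m\<^sub>i) / s\<^sub>i)\<^sup>2\<^sup>n)\<close>, which tend to the indicator function of a box as \<open>n\<close> grows. From boxes one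
  passes to bounded Borel sets by a Dynkin system argument, then to simple functions, and then to all of \<open>L\<^sup>2\<close>.
\<close>

section \<open>Square-integrable functions and their inner product\<close>

lemma square_integrable_rep_L2: "square_integrable (rep_L2 f)"
  using Quotient_rep_reflp[OF Quotient_L2, of f] by (simp add: L2_rel_def)

lemma abs_L2_rep_L2: "abs_L2 (rep_L2 f) = f"
  by (rule Quotient_abs_rep[OF Quotient_L2])

lemma rep_L2_abs_L2:
  assumes "square_integrable f"
  shows "AE t in lborel. rep_L2 (abs_L2 f) t = f t"
  using Quotient_rep_abs[OF Quotient_L2, of f] assms by (simp add: L2_rel_def)

lemma abs_L2_add:
  assumes "square_integrable f" "square_integrable g"
  shows "abs_L2 f + abs_L2 g = abs_L2 (\<lambda>t. f t + g t)"
  using assms by (simp add: plus_L2.abs_eq L2_rel_def)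

lemma abs_L2_scaleC:
  assumes "square_integrable f"
  shows "c *\<^sub>C abs_L2 f = abs_L2 (\<lambda>t. c * f t)"
  using assms by (simp add: scaleC.abs_eq L2_rel_def)

lemma square_integrable_diff:
  assumes "square_integrable f" "square_integrable g"
  shows "square_integrable (\<lambda>t. f t - g t)"
  using square_integrable_add[OF assms(1) square_integrable_scale[OF assms(2), of "-1"]] by simp

lemma abs_L2_diff:
  assumes "square_integrable f" "square_integrable g"
  shows "abs_L2 f - abs_L2 g = abs_L2 (\<lambda>t. f t - g t)"
proof -
  have "abs_L2 f - abs_L2 g = abs_L2 f + abs_L2 (\<lambda>t. - 1 * g t)"
    unfolding minus_L2_def uminus_L2_def by (simp only: abs_L2_scaleC[OF assms(2)])
  also have "\<dots> = abs_L2 (\<lambda>t. f t + - 1 * g t)"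
    by (rule abs_L2_add[OF assms(1) square_integrable_scale[OF assms(2)]])
  also have "\<dots> = abs_L2 (\<lambda>t. f t - g t)"
    by simp
  finally show ?thesis .
qed

lemma norm_abs_L2_power2:
  assumes "square_integrable f"
  shows "(norm (abs_L2 f))\<^sup>2 = (LINT t|lborel. (cmod (f t))\<^sup>2)"
proof -
  have "(norm (abs_L2 f))\<^sup>2 = Re (cinner (abs_L2 f) (abs_L2 f))"
    by (simp add: power2_norm_eq_inner inner_L2_def)
  also have "\<dots> = Re (LINT t|lborel. f t * cnj (f t))"
    using assms by (simp add: cinner.abs_eq L2_rel_def)
  also have "\<dots> = (LINT t|lborel. (cmod (f t))\<^sup>2)"
    by (simp add: complex_norm_square [symmetric] flip: of_real_power)
  finally show ?thesis .
qed

lemma cinner_add_left: "cinner (f + g) h = cinner f h + cinner g h"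
  by transfer (simp add: L2_rel_def distrib_right square_integrable_mult_cnj)

lemma cinner_scaleC_left: "cinner (c *\<^sub>C f) g = c * cinner f g"
  by transfer (simp add: mult.assoc)

lemma cinner_commute: "cinner f g = cnj (cinner g f)"
proof transfer
  fix f g :: "'a \<Rightarrow> complex"
  have "(\<lambda>t. f t * cnj (g t)) = (\<lambda>t. cnj (g t * cnj (f t)))"
    by (simp add: mult.commute)
  then show "(LINT t|lborel. f t * cnj (g t)) = cnj (LINT t|lborel. g t * cnj (f t))"
    by (simp only: Bochner_Integration.integral_cnj)
qed

lemma cinner_add_right: "cinner h (f + g) = cinner h f + cinner h g"
  by (metis cinner_commute cinner_add_left complex_cnj_add)

lemma cinner_scaleC_right: "cinner f (c *\<^sub>C g) = cnj c * cinner f g"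
  by (metis cinner_commute cinner_scaleC_left complex_cnj_mult)

lemma scaleR_L2_eq_scaleC: "r *\<^sub>R f = complex_of_real r *\<^sub>C f" for f :: "'a::euclidean_space L2"
  by (simp add: scaleR_L2_def)

lemma cinner_self: "cinner f f = complex_of_real ((norm f)\<^sup>2)"
proof (rule complex_eqI)
  show "Re (cinner f f) = Re (complex_of_real ((norm f)\<^sup>2))"
    by (simp only: power2_norm_eq_inner inner_L2_def Re_complex_of_real)
  have "Im (cinner f f) = - Im (cinner f f)"
    using arg_cong[OF cinner_commute[of f f], of Im] by (simp only: cnj.sel)
  then show "Im (cinner f f) = Im (complex_of_real ((norm f)\<^sup>2))"
    by (simp only: Im_complex_of_real)
qed

lemma norm_scaleC: "norm (c *\<^sub>C f) = cmod c * norm f"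
proof -
  have "complex_of_real ((norm (c *\<^sub>C f))\<^sup>2) = (c * cnj c) * cinner f f"
    unfolding cinner_self[symmetric] cinner_scaleC_left cinner_scaleC_right by (simp only: ac_simps)
  also have "\<dots> = complex_of_real ((cmod c * norm f)\<^sup>2)"
    unfolding cinner_self complex_norm_square[symmetric] power_mult_distrib of_real_mult by (rule refl)
  finally have "(norm (c *\<^sub>C f))\<^sup>2 = (cmod c * norm f)\<^sup>2"
    by (simp only: of_real_eq_iff)
  then show ?thesis by (rule power2_eq_imp_eq) simp_all
qed

text \<open>Rotating \<open>f\<close> by a unimodular scalar makes the complex inner product real and nonnegative, where it is
  the real inner product of the type class.\<close>

lemma cinner_Cauchy_Schwarz: "cmod (cinner f g) \<le> norm f * norm g"
proof (cases "cinner f g = 0")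
  case False
  define c where "c = cnj (sgn (cinner f g))"
  have c: "cmod c = 1"
    using False by (simp add: c_def norm_sgn)
  have "c * cinner f g = complex_of_real (cmod (cinner f g))"
    using False complex_norm_square[of "cinner f g"]
    by (simp add: c_def sgn_eq field_simps power2_eq_square)
  then have "cmod (cinner f g) = (c *\<^sub>C f) \<bullet> g"
    by (simp add: inner_L2_def cinner_scaleC_left)
  also have "\<dots> \<le> norm (c *\<^sub>C f) * norm g"
    by (rule norm_cauchy_schwarz)
  finally show ?thesis by (simp add: norm_scaleC c)
qed simp

lemma bounded_bilinear_cinner:
  "bounded_bilinear (cinner :: 'a::euclidean_space L2 \<Rightarrow> 'a L2 \<Rightarrow> complex)"
proof
  show "\<exists>K. \<forall>a b. norm (cinner a b) \<le> norm a * norm b * K"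
    by (rule exI[of _ 1], intro allI) (simp only: mult_1_right cinner_Cauchy_Schwarz)
  show "cinner (r *\<^sub>R f) g = r *\<^sub>R cinner f g" for r and f g :: "'a L2"
    by (simp only: scaleR_L2_eq_scaleC cinner_scaleC_left scaleR_conv_of_real)
  show "cinner f (r *\<^sub>R g) = r *\<^sub>R cinner f g" for r and f g :: "'a L2"
    by (simp only: scaleR_L2_eq_scaleC cinner_scaleC_right scaleR_conv_of_real complex_cnj_complex_of_real)
qed (rule cinner_add_left cinner_add_right)+

lemma bounded_linear_scaleC: "bounded_linear (\<lambda>f. c *\<^sub>C f)"
proof (rule bounded_linear_intro[of _ "cmod c"])
  show "c *\<^sub>C (r *\<^sub>R f) = r *\<^sub>R (c *\<^sub>C f)" for r and f :: "'a L2"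
    unfolding scaleR_L2_eq_scaleC scaleC_scaleC by (simp only: mult.commute)
  show "norm (c *\<^sub>C f) \<le> norm f * cmod c" for f :: "'a L2"
    unfolding norm_scaleC by (simp only: mult.commute order_refl)
qed (rule scaleC_add_right)

lemma square_integrable_AE_dominated:
  assumes f: "f \<in> borel_measurable borel" and w: "square_integrable w"
    and le: "AE t in lborel. cmod (f t) \<le> cmod (w t)"
  shows "square_integrable f"
  unfolding square_integrable_def
proof (rule conjI[OF f])
  show "integrable lborel (\<lambda>t. (cmod (f t))\<^sup>2)"
  proof (rule Bochner_Integration.integrable_bound[of _ "\<lambda>t. (cmod (w t))\<^sup>2"])
    show "AE t in lborel. norm ((cmod (f t))\<^sup>2) \<le> norm ((cmod (w t))\<^sup>2)"
      using le by eventually_elim (simp add: power_mono)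
  qed (use f w in \<open>auto simp: square_integrable_def\<close>)
qed

text \<open>Dominated convergence in mean square: \<open>\<bar>s\<^sub>i - f\<bar>\<^sup>2\<close> is dominated by \<open>4 \<bar>w\<bar>\<^sup>2\<close>.\<close>

lemma tendsto_abs_L2_dominated:
  fixes f :: "'a::euclidean_space \<Rightarrow> complex"
  assumes f: "f \<in> borel_measurable borel" and s: "\<And>i::nat. s i \<in> borel_measurable borel"
    and w: "square_integrable w"
    and le: "\<And>i. AE t in lborel. cmod (s i t) \<le> cmod (w t)"
    and lim: "AE t in lborel. (\<lambda>i. s i t) \<longlonglongrightarrow> f t"
  shows "square_integrable f" and "(\<lambda>i. abs_L2 (s i)) \<longlonglongrightarrow> abs_L2 f"
proof -
  have all: "AE t in lborel. \<forall>i. cmod (s i t) \<le> cmod (w t)"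
    using le by (simp add: AE_all_countable)
  with lim have lef: "AE t in lborel. cmod (f t) \<le> cmod (w t)"
    by eventually_elim (rule LIMSEQ_le_const2[OF tendsto_norm], auto)
  show sf: "square_integrable f"
    by (rule square_integrable_AE_dominated[OF f w lef])
  have ss: "square_integrable (s i)" for i
    by (rule square_integrable_AE_dominated[OF s w le])
  have "(\<lambda>i. LINT t|lborel. (cmod (s i t - f t))\<^sup>2) \<longlonglongrightarrow> (LINT t::'a|lborel. (0::real))"
  proof (rule integral_dominated_convergence[where w="\<lambda>t. 4 * (cmod (w t))\<^sup>2"])
    show "AE t in lborel. (\<lambda>i. (cmod (s i t - f t))\<^sup>2) \<longlonglongrightarrow> 0"
      using lim
    proof eventually_elim
      fix t assume "(\<lambda>i. s i t) \<longlonglongrightarrow> f t"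
      then have "(\<lambda>i. (cmod (s i t - f t))\<^sup>2) \<longlonglongrightarrow> (cmod (f t - f t))\<^sup>2"
        by (intro tendsto_intros)
      then show "(\<lambda>i. (cmod (s i t - f t))\<^sup>2) \<longlonglongrightarrow> 0" by simp
    qed
    show "AE t in lborel. norm ((cmod (s i t - f t))\<^sup>2) \<le> 4 * (cmod (w t))\<^sup>2" for i
      using le[of i] lef
    proof eventually_elim
      fix t assume "cmod (s i t) \<le> cmod (w t)" "cmod (f t) \<le> cmod (w t)"
      then have "cmod (s i t - f t) \<le> 2 * cmod (w t)"
        using norm_triangle_ineq4[of "s i t" "f t"] by linarith
      then have "(cmod (s i t - f t))\<^sup>2 \<le> (2 * cmod (w t))\<^sup>2"
        by (intro power_mono) auto
      then show "norm ((cmod (s i t - f t))\<^sup>2) \<le> 4 * (cmod (w t))\<^sup>2"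
        by (simp add: power_mult_distrib)
    qed
  qed (use f s w in \<open>auto simp: square_integrable_def\<close>)
  then have "(\<lambda>i. (norm (abs_L2 (s i) - abs_L2 f))\<^sup>2) \<longlonglongrightarrow> 0"
    by (simp add: abs_L2_diff norm_abs_L2_power2 ss sf square_integrable_diff)
  then have "(\<lambda>i. sqrt ((norm (abs_L2 (s i) - abs_L2 f))\<^sup>2)) \<longlonglongrightarrow> sqrt 0"
    by (rule tendsto_real_sqrt)
  then show "(\<lambda>i. abs_L2 (s i)) \<longlonglongrightarrow> abs_L2 f"
    by (simp add: tendsto_norm_zero_iff LIM_zero_iff)
qed


section \<open>Completeness\<close>

lemma nn_integral_cmod_power2_L2:
  assumes "square_integrable f"
  shows "(\<integral>\<^sup>+t. ennreal ((cmod (f t))\<^sup>2) \<partial>lborel) = ennreal ((norm (abs_L2 f))\<^sup>2)"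
  using assms by (simp add: norm_abs_L2_power2 nn_integral_eq_integral square_integrable_def)

text \<open>The steps \<open>d\<^sub>k\<close> of the sequence satisfy \<open>\<integral> \<bar>d\<^sub>k\<bar>\<^sup>2 \<le> 4\<^sup>-\<^sup>k\<close>, which leaves room for the weights \<open>2\<^sup>k\<close>:
  the series \<open>\<Sum>k. 2\<^sup>k \<bar>d\<^sub>k\<bar>\<^sup>2\<close> has a finite integral, hence is finite almost everywhere, and this forces
  the telescoping series \<open>\<Sum>k. d\<^sub>k\<close> to converge absolutely.\<close>

lemma AE_convergent_of_fast_Cauchy:
  fixes u :: "nat \<Rightarrow> 'a::euclidean_space \<Rightarrow> complex"
  assumes u: "\<And>k. square_integrable (u k)"
    and fast: "\<And>k. norm (abs_L2 (u (Suc k)) - abs_L2 (u k)) \<le> (1/2) ^ k"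
  shows "AE t in lborel. convergent (\<lambda>k. u k t)"
proof -
  define d where "d k t = u (Suc k) t - u k t" for k t
  have d: "square_integrable (d k)" for k
    unfolding d_def by (intro square_integrable_diff u)
  have d_meas [measurable]: "d k \<in> borel_measurable borel" for k
    using d by (simp add: square_integrable_def)
  have int_d: "(\<integral>\<^sup>+t. ennreal (2 ^ k * (cmod (d k t))\<^sup>2) \<partial>lborel) \<le> ennreal ((1/2) ^ k)" for k
  proof -
    have "abs_L2 (d k) = abs_L2 (u (Suc k)) - abs_L2 (u k)"
      unfolding d_def by (simp add: abs_L2_diff u)
    then have "(norm (abs_L2 (d k)))\<^sup>2 \<le> ((1/2) ^ k)\<^sup>2"
      using fast[of k] by (intro power_mono) auto
    then have "2 ^ k * (norm (abs_L2 (d k)))\<^sup>2 \<le> 2 ^ k * ((1/2) ^ k)\<^sup>2"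
      by (intro mult_left_mono) auto
    also have "\<dots> = (1/2) ^ k"
      by (simp add: power2_eq_square power_divide)
    finally have "2 ^ k * (norm (abs_L2 (d k)))\<^sup>2 \<le> (1/2) ^ k" .
    moreover have "(\<integral>\<^sup>+t. ennreal (2 ^ k * (cmod (d k t))\<^sup>2) \<partial>lborel)
        = ennreal (2 ^ k * (norm (abs_L2 (d k)))\<^sup>2)"
      by (simp add: ennreal_mult nn_integral_cmult nn_integral_cmod_power2_L2 d)
    ultimately show ?thesis
      by (simp add: ennreal_leI)
  qed
  have "(\<integral>\<^sup>+t. (\<Sum>k. ennreal (2 ^ k * (cmod (d k t))\<^sup>2)) \<partial>lborel)
      = (\<Sum>k. \<integral>\<^sup>+t. ennreal (2 ^ k * (cmod (d k t))\<^sup>2) \<partial>lborel)"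
    by (rule nn_integral_suminf) simp
  also have "\<dots> \<le> (\<Sum>k. ennreal ((1/2) ^ k))"
    by (intro suminf_le int_d) auto
  also have "\<dots> = ennreal (\<Sum>k. (1/2) ^ k)"
    by (intro suminf_ennreal2) (auto intro: summable_geometric)
  also have "\<dots> < \<infinity>" by simp
  finally have "AE t in lborel. (\<Sum>k. ennreal (2 ^ k * (cmod (d k t))\<^sup>2)) \<noteq> \<infinity>"
    by (intro nn_integral_PInf_AE) auto
  then show ?thesis
  proof eventually_elim
    fix t
    assume "(\<Sum>k. ennreal (2 ^ k * (cmod (d k t))\<^sup>2)) \<noteq> \<infinity>"
    then have "summable (\<lambda>k. 2 ^ k * (cmod (d k t))\<^sup>2)"
      by (intro summable_suminf_not_top) auto
    then have "summable (\<lambda>k. 2 ^ k * (cmod (d k t))\<^sup>2 + (1/2) ^ k)"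
      by (intro summable_add summable_geometric) auto
    then have "summable (\<lambda>k. d k t)"
    proof (rule summable_comparison_test[rotated], intro exI[of _ 0] allI impI)
      fix k
      \<comment> \<open>The weights \<open>2 ^ k\<close> turn square summability into summability: \<open>x \<le> w x\<^sup>2 + 1 / w\<close>.\<close>
      have "0 \<le> (2 ^ k * cmod (d k t) - 1)\<^sup>2 + 2 ^ k * cmod (d k t)" by simp
      then have "0 \<le> 2 ^ k * (2 ^ k * (cmod (d k t))\<^sup>2 + (1/2) ^ k - cmod (d k t))"
        by (simp add: power2_eq_square algebra_simps flip: power_mult_distrib)
      then show "norm (d k t) \<le> 2 ^ k * (cmod (d k t))\<^sup>2 + (1/2) ^ k"
        by (simp add: zero_le_mult_iff power_le_zero_eq)
    qed
    then have "convergent (\<lambda>n. u 0 t + (\<Sum>k<n. d k t))"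
      by (intro convergent_add convergent_const) (simp add: summable_iff_convergent)
    moreover have "u 0 t + (\<Sum>k<n. d k t) = u n t" for n
      using sum_lessThan_telescope[of "\<lambda>k. u k t" n] by (simp add: d_def)
    ultimately show "convergent (\<lambda>k. u k t)" by simp
  qed
qed

text \<open>Fatou's lemma, applied in \<open>j\<close> to \<open>\<bar>u\<^sub>j - u\<^sub>k\<bar>\<^sup>2\<close>, carries the Cauchy bound over to the pointwise limit.\<close>

lemma L2_tendsto_of_AE_tendsto_Cauchy:
  fixes u :: "nat \<Rightarrow> 'a::euclidean_space \<Rightarrow> complex"
  assumes u: "\<And>k. square_integrable (u k)" and "Cauchy (\<lambda>k. abs_L2 (u k))"
    and v[measurable]: "v \<in> borel_measurable borel"
    and lim: "AE t in lborel. (\<lambda>k. u k t) \<longlonglongrightarrow> v t"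
  shows "square_integrable v" and "(\<lambda>k. abs_L2 (u k)) \<longlonglongrightarrow> abs_L2 v"
proof -
  have u_meas [measurable]: "u k \<in> borel_measurable borel" for k
    using u by (simp add: square_integrable_def)
  have bound: "(\<integral>\<^sup>+t. ennreal ((cmod (v t - u k t))\<^sup>2) \<partial>lborel) \<le> ennreal (e\<^sup>2)"
    if e: "0 \<le> e" "\<And>j. k \<le> j \<Longrightarrow> norm (abs_L2 (u j) - abs_L2 (u k)) \<le> e" for k e
  proof -
    have "(\<integral>\<^sup>+t. ennreal ((cmod (v t - u k t))\<^sup>2) \<partial>lborel)
        = (\<integral>\<^sup>+t. liminf (\<lambda>j. ennreal ((cmod (u j t - u k t))\<^sup>2)) \<partial>lborel)"
    proof (rule nn_integral_cong_AE)
      show "AE t in lborel. ennreal ((cmod (v t - u k t))\<^sup>2)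
          = liminf (\<lambda>j. ennreal ((cmod (u j t - u k t))\<^sup>2))"
        using lim
      proof eventually_elim
        fix t assume "(\<lambda>k. u k t) \<longlonglongrightarrow> v t"
        then have "(\<lambda>j. ennreal ((cmod (u j t - u k t))\<^sup>2)) \<longlonglongrightarrow> ennreal ((cmod (v t - u k t))\<^sup>2)"
          by (intro tendsto_ennrealI tendsto_intros)
        then show "ennreal ((cmod (v t - u k t))\<^sup>2) = liminf (\<lambda>j. ennreal ((cmod (u j t - u k t))\<^sup>2))"
          by (intro lim_imp_Liminf[symmetric]) simp_all
      qed
    qed
    also have "\<dots> \<le> liminf (\<lambda>j. \<integral>\<^sup>+t. ennreal ((cmod (u j t - u k t))\<^sup>2) \<partial>lborel)"
      by (rule nn_integral_liminf) measurable
    also have "\<dots> \<le> liminf (\<lambda>j::nat. ennreal (e\<^sup>2))"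
    proof (rule Liminf_mono, rule eventually_sequentiallyI[of k])
      fix j assume "k \<le> j"
      then have "(norm (abs_L2 (u j) - abs_L2 (u k)))\<^sup>2 \<le> e\<^sup>2"
        using e by (intro power_mono) auto
      then show "(\<integral>\<^sup>+t. ennreal ((cmod (u j t - u k t))\<^sup>2) \<partial>lborel) \<le> ennreal (e\<^sup>2)"
        by (simp add: nn_integral_cmod_power2_L2 square_integrable_diff u abs_L2_diff ennreal_leI)
    qed
    also have "\<dots> = ennreal (e\<^sup>2)"
      by (simp add: Liminf_const)
    finally show ?thesis .
  qed
  have tail: "\<exists>K. \<forall>k\<ge>K. \<forall>j\<ge>k. norm (abs_L2 (u j) - abs_L2 (u k)) \<le> e" if "0 < e" for e
    using CauchyD[OF assms(2) that] by (meson less_imp_le order_trans)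
  have diff: "square_integrable (\<lambda>t. v t - u k t)"
    if e: "0 \<le> e" "\<And>j. k \<le> j \<Longrightarrow> norm (abs_L2 (u j) - abs_L2 (u k)) \<le> e" for k e
    unfolding square_integrable_def
  proof (intro conjI integrableI_nonneg)
    show "(\<integral>\<^sup>+t. ennreal ((cmod (v t - u k t))\<^sup>2) \<partial>lborel) < \<infinity>"
      by (rule le_less_trans[OF bound[OF e]]) auto
  qed auto
  obtain K where K: "\<And>j. K \<le> j \<Longrightarrow> norm (abs_L2 (u j) - abs_L2 (u K)) \<le> 1"
    using tail[of 1] by auto
  show v_sq: "square_integrable v"
    using square_integrable_add[OF diff[OF zero_le_one K] u[of K]] by simp
  show "(\<lambda>k. abs_L2 (u k)) \<longlonglongrightarrow> abs_L2 v"
  proof (rule metric_LIMSEQ_I)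
    fix r :: real assume "0 < r"
    then obtain K where K: "\<And>k j. K \<le> k \<Longrightarrow> k \<le> j \<Longrightarrow> norm (abs_L2 (u j) - abs_L2 (u k)) \<le> r / 2"
      using tail[of "r / 2"] by auto
    have "dist (abs_L2 (u k)) (abs_L2 v) < r" if "K \<le> k" for k
    proof -
      have "ennreal ((norm (abs_L2 v - abs_L2 (u k)))\<^sup>2) \<le> ennreal ((r / 2)\<^sup>2)"
        using bound[of "r / 2" k] K[OF that] \<open>0 < r\<close>
        by (simp add: nn_integral_cmod_power2_L2 square_integrable_diff u v_sq abs_L2_diff)
      then have "norm (abs_L2 v - abs_L2 (u k)) \<le> r / 2"
        using \<open>0 < r\<close> by (simp add: power_mono_iff)
      then show ?thesis
        using \<open>0 < r\<close> by (simp add: dist_norm norm_minus_commute)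
    qed
    then show "\<exists>no. \<forall>n\<ge>no. dist (abs_L2 (u n)) (abs_L2 v) < r" by blast
  qed
qed

text \<open>The Riesz--Fischer theorem. A subsequence whose successive distances decay geometrically converges
  almost everywhere, its limit is a limit in mean square, and a Cauchy sequence converges along with
  any subsequence.\<close>

instance L2 :: (euclidean_space) complete_space
proof
  fix X :: "nat \<Rightarrow> 'a L2"
  assume X: "Cauchy X"
  have "\<forall>k. \<exists>N. \<forall>m\<ge>N. \<forall>n\<ge>N. norm (X m - X n) < (1/2) ^ k"
    using CauchyD[OF X] by simp
  then obtain N where N: "\<And>k m n. N k \<le> m \<Longrightarrow> N k \<le> n \<Longrightarrow> norm (X m - X n) < (1/2) ^ k"
    by metis
  \<comment> \<open>The summand \<open>k\<close> makes the subsequence strictly increasing, the sum puts it beyond \<open>N k\<close>.\<close>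
  define r where "r k = k + (\<Sum>i\<le>k. N i)" for k
  have r: "strict_mono r"
    unfolding r_def by (rule strict_monoI_Suc) simp
  have r_ge: "N k \<le> r k" for k
    unfolding r_def by (simp add: member_le_sum trans_le_add2)
  define u where "u k = rep_L2 (X (r k))" for k
  have u: "square_integrable (u k)" and abs_u: "abs_L2 (u k) = X (r k)" for k
    by (simp_all add: u_def square_integrable_rep_L2 abs_L2_rep_L2)
  have [measurable]: "u k \<in> borel_measurable borel" for k
    using u by (simp add: square_integrable_def)
  have "norm (abs_L2 (u (Suc k)) - abs_L2 (u k)) \<le> (1/2) ^ k" for k
  proof -
    have "N k \<le> r (Suc k)"
      using r_ge[of k] strict_mono_less[OF r, of k "Suc k"] by simp
    then show ?thesis
      using N[of k "r (Suc k)" "r k"] r_ge[of k] by (simp add: abs_u)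
  qed
  then have "AE t in lborel. convergent (\<lambda>k. u k t)"
    by (rule AE_convergent_of_fast_Cauchy[OF u])
  then have lim: "AE t in lborel. (\<lambda>k. u k t) \<longlonglongrightarrow> lim (\<lambda>k. u k t)"
    by eventually_elim (simp add: convergent_LIMSEQ_iff)
  have v: "(\<lambda>t. lim (\<lambda>k. u k t)) \<in> borel_measurable borel"
    by measurable
  have "Cauchy (\<lambda>k. abs_L2 (u k))"
    using Cauchy_subseq_Cauchy[OF X r] by (simp add: abs_u o_def)
  then have "(X \<circ> r) \<longlonglongrightarrow> abs_L2 (\<lambda>t. lim (\<lambda>k. u k t))"
    using L2_tendsto_of_AE_tendsto_Cauchy(2)[OF u _ v lim] by (simp add: abs_u o_def)
  then show "convergent X"
    using Cauchy_converges_subseq[OF X r] by (auto simp: convergent_def)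
qed


section \<open>Orthonormal systems and diagonal operators\<close>

lemma complex_subspace_closure:
  assumes "L2.subspace M"
  shows "L2.subspace (closure M)"
proof (rule L2.subspaceI)
  show "0 \<in> closure M"
    using L2.subspace_0[OF assms] closure_subset by blast
next
  fix f g assume "f \<in> closure M" "g \<in> closure M"
  then obtain a b where "\<And>n::nat. a n \<in> M" "a \<longlonglongrightarrow> f" "\<And>n::nat. b n \<in> M" "b \<longlonglongrightarrow> g"
    unfolding closure_sequential by blast
  then have "\<And>n. a n + b n \<in> M" "(\<lambda>n. a n + b n) \<longlonglongrightarrow> f + g"
    by (auto intro: L2.subspace_add[OF assms] tendsto_add)
  then show "f + g \<in> closure M"
    unfolding closure_sequential by (intro exI[of _ "\<lambda>n. a n + b n"]) auto
next
  fix c f assume "f \<in> closure M"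
  then obtain a where "\<And>n::nat. a n \<in> M" "a \<longlonglongrightarrow> f"
    unfolding closure_sequential by blast
  then have "\<And>n. c *\<^sub>C a n \<in> M" "(\<lambda>n. c *\<^sub>C a n) \<longlonglongrightarrow> c *\<^sub>C f"
    by (auto intro: L2.subspace_scale[OF assms] bounded_linear.tendsto[OF bounded_linear_scaleC])
  then show "c *\<^sub>C f \<in> closure M"
    unfolding closure_sequential by (intro exI[of _ "\<lambda>n. c *\<^sub>C a n"]) auto
qed

lemma cinner_simps:
  "cinner (f + g) h = cinner f h + cinner g h"
  "cinner h (f + g) = cinner h f + cinner h g"
  "cinner (c *\<^sub>C f) g = c * cinner f g"
  "cinner f (c *\<^sub>C g) = cnj c * cinner f g"
  "cinner (f - g) h = cinner f h - cinner g h"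
  "cinner h (f - g) = cinner h f - cinner h g"
  "cinner 0 h = 0" "cinner h 0 = 0"
  "cinner (sum a I) h = (\<Sum>i\<in>I. cinner (a i) h)"
  "cinner h (sum a I) = (\<Sum>i\<in>I. cinner h (a i))"
  by (rule cinner_add_left cinner_add_right cinner_scaleC_left cinner_scaleC_right
      bounded_bilinear.diff_left[OF bounded_bilinear_cinner]
      bounded_bilinear.diff_right[OF bounded_bilinear_cinner]
      bounded_bilinear.zero_left[OF bounded_bilinear_cinner]
      bounded_bilinear.zero_right[OF bounded_bilinear_cinner]
      bounded_bilinear.sum_left[OF bounded_bilinear_cinner]
      bounded_bilinear.sum_right[OF bounded_bilinear_cinner])+

lemma norm_power2_add_of_orthogonal:
  assumes "cinner f g = 0"
  shows "(norm (f + g))\<^sup>2 = (norm f)\<^sup>2 + (norm g)\<^sup>2"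
proof -
  have "cinner g f = 0"
    using assms cinner_commute[of g f] by simp
  then have "complex_of_real ((norm (f + g))\<^sup>2) = complex_of_real ((norm f)\<^sup>2 + (norm g)\<^sup>2)"
    unfolding of_real_add cinner_self[symmetric] using assms by (simp add: cinner_simps)
  then show ?thesis by (simp only: of_real_eq_iff)
qed

lemma cinner_orthonormal_sum:
  assumes "orthonormal_system UNIV \<psi>" "finite I"
  shows "cinner (\<Sum>n\<in>I. a n *\<^sub>C \<psi> n) (\<psi> m) = (if m \<in> I then a m else 0)"
proof -
  have "cinner (\<Sum>n\<in>I. a n *\<^sub>C \<psi> n) (\<psi> m) = (\<Sum>n\<in>I. if n = m then a n else 0)"
    using assms(1) by (auto simp: cinner_simps orthonormal_system_def intro!: sum.cong)
  then show ?thesis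
    using assms(2) by simp
qed

lemma norm_orthonormal_sum:
  assumes "orthonormal_system UNIV \<psi>" "finite I"
  shows "(norm (\<Sum>n\<in>I. a n *\<^sub>C \<psi> n))\<^sup>2 = (\<Sum>n\<in>I. (cmod (a n))\<^sup>2)"
proof -
  have "complex_of_real ((norm (\<Sum>n\<in>I. a n *\<^sub>C \<psi> n))\<^sup>2)
      = (\<Sum>m\<in>I. cnj (a m) * cinner (\<Sum>n\<in>I. a n *\<^sub>C \<psi> n) (\<psi> m))"
    unfolding cinner_self[symmetric] by (subst cinner_simps(10)) (simp only: cinner_simps(4))
  also have "\<dots> = (\<Sum>m\<in>I. cnj (a m) * a m)"
    by (intro sum.cong refl) (simp only: cinner_orthonormal_sum[OF assms] if_True)
  also have "\<dots> = complex_of_real (\<Sum>n\<in>I. (cmod (a n))\<^sup>2)"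
    unfolding of_real_sum complex_norm_square by (simp only: mult.commute)
  finally show ?thesis by (simp only: of_real_eq_iff)
qed

text \<open>The Fourier coefficients give the best approximation of \<open>f\<close> by combinations of the \<open>\<psi> n\<close>, and the
  excess error of any other choice of coefficients is explicit. Both Bessel's inequality (all
  coefficients zero) and the convergence of Fourier series come from this identity.\<close>

lemma norm_power2_minus_orthonormal_sum:
  assumes "orthonormal_system UNIV \<psi>" "finite I"
  shows "(norm (f - (\<Sum>n\<in>I. a n *\<^sub>C \<psi> n)))\<^sup>2
    = (norm (f - (\<Sum>n\<in>I. cinner f (\<psi> n) *\<^sub>C \<psi> n)))\<^sup>2 + (\<Sum>n\<in>I. (cmod (cinner f (\<psi> n) - a n))\<^sup>2)"
proof -
  let ?p = "\<Sum>n\<in>I. cinner f (\<psi> n) *\<^sub>C \<psi> n" and ?q = "\<Sum>n\<in>I. (cinner f (\<psi> n) - a n) *\<^sub>C \<psi> n"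
  have "cinner (f - ?p) (\<psi> m) = 0" if "m \<in> I" for m
    using that cinner_orthonormal_sum[OF assms, of "\<lambda>n. cinner f (\<psi> n)"] by (simp add: cinner_simps(5))
  then have "cinner (f - ?p) ?q = 0"
    by (simp add: cinner_simps(4,10))
  moreover have "f - (\<Sum>n\<in>I. a n *\<^sub>C \<psi> n) = (f - ?p) + ?q"
    by (simp add: L2.scale_left_diff_distrib sum_subtractf)
  ultimately show ?thesis
    using norm_power2_add_of_orthogonal[of "f - ?p" ?q] by (simp only: norm_orthonormal_sum[OF assms])
qed

lemma Bessel_inequality:
  assumes "orthonormal_system UNIV \<psi>" "finite I"
  shows "(\<Sum>n\<in>I. (cmod (cinner f (\<psi> n)))\<^sup>2) \<le> (norm f)\<^sup>2"
  using norm_power2_minus_orthonormal_sum[OF assms, of f "\<lambda>_. 0"] by simp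

text \<open>In contrast to absolute summability, this criterion applies to orthogonal series, where only the
  squares of the norms are summable.\<close>

lemma summable_onI_Cauchy:
  fixes f :: "'i \<Rightarrow> 'b::{complete_space, real_normed_vector}"
  assumes "\<And>e. 0 < e \<Longrightarrow> \<exists>F. finite F \<and> F \<subseteq> A \<and>
      (\<forall>G. finite G \<longrightarrow> G \<subseteq> A \<longrightarrow> G \<inter> F = {} \<longrightarrow> norm (sum f G) < e)"
  shows "f summable_on A"
proof -
  have "\<exists>P. eventually P (finite_subsets_at_top A) \<and>
      (\<forall>G H. P G \<and> P H \<longrightarrow> dist (sum f G) (sum f H) < e)" if "0 < e" for e
  proof -
    obtain F where F: "finite F" "F \<subseteq> A"
      and small: "\<And>G. finite G \<Longrightarrow> G \<subseteq> A \<Longrightarrow> G \<inter> F = {} \<Longrightarrow> norm (sum f G) < e / 2"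
      using assms[of "e / 2"] \<open>0 < e\<close> by auto
    have near: "dist (sum f G) (sum f F) < e / 2" if "finite G" "F \<subseteq> G" "G \<subseteq> A" for G
      using small[of "G - F"] that by (auto simp: dist_norm sum_diff)
    have "eventually (\<lambda>G. finite G \<and> F \<subseteq> G \<and> G \<subseteq> A) (finite_subsets_at_top A)"
      using F by (auto simp: eventually_finite_subsets_at_top)
    then show ?thesis
      using dist_triangle_half_l[OF near near] by (intro exI conjI) auto
  qed
  then have "cauchy_filter (filtermap (sum f) (finite_subsets_at_top A))"
    by (simp add: cauchy_filter_metric_filtermap)
  moreover have "complete (UNIV :: 'b set)"
    by (rule complete_UNIV)
  ultimately obtain l where "(sum f \<longlongrightarrow> l) (finite_subsets_at_top A)"
    using complete_uniform[where S="UNIV :: 'b set"] by (force simp: filterlim_def)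
  then show ?thesis
    by (auto simp: summable_on_def has_sum_def)
qed

text \<open>By Bessel's inequality the finite sums of \<open>\<bar>\<langle>f, \<psi>\<^sub>n\<rangle>\<bar>\<^sup>2\<close> are bounded; once a finite index set nearly attains
  their supremum, every disjoint finite block has a small norm, and completeness of the space applies.\<close>

lemma Fourier_series_summable:
  fixes \<psi> :: "'i \<Rightarrow> 'a::euclidean_space L2"
  assumes on: "orthonormal_system UNIV \<psi>"
  shows "(\<lambda>n. cinner f (\<psi> n) *\<^sub>C \<psi> n) summable_on UNIV"
proof (rule summable_onI_Cauchy)
  fix e :: real assume "0 < e"
  let ?c = "\<lambda>n. (cmod (cinner f (\<psi> n)))\<^sup>2"
  define s where "s = (SUP I\<in>{I. finite I}. sum ?c I)"
  have bdd: "bdd_above (sum ?c ` {I. finite I})"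
    using Bessel_inequality[OF on, of _ f] by (intro bdd_aboveI[of _ "(norm f)\<^sup>2"]) auto
  have "s - e\<^sup>2 < s" using \<open>0 < e\<close> by simp
  then obtain F where F: "finite F" "s - e\<^sup>2 < sum ?c F"
    unfolding s_def by (subst (asm) less_cSUP_iff[OF _ bdd]) auto
  show "\<exists>F. finite F \<and> F \<subseteq> UNIV \<and> (\<forall>G. finite G \<longrightarrow> G \<subseteq> UNIV \<longrightarrow> G \<inter> F = {} \<longrightarrow>
      norm (\<Sum>n\<in>G. cinner f (\<psi> n) *\<^sub>C \<psi> n) < e)"
  proof (intro exI[of _ F] conjI allI impI F(1))
    fix G assume G: "finite G" "G \<inter> F = {}"
    have "sum ?c G + sum ?c F = sum ?c (G \<union> F)"
      using G F(1) by (simp add: sum.union_disjoint)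
    also have "\<dots> \<le> s"
      unfolding s_def using G F(1) by (intro cSUP_upper bdd) auto
    finally have "(norm (\<Sum>n\<in>G. cinner f (\<psi> n) *\<^sub>C \<psi> n))\<^sup>2 < e\<^sup>2"
      using F(2) norm_orthonormal_sum[OF on G(1), of "\<lambda>n. cinner f (\<psi> n)"] by linarith
    then show "norm (\<Sum>n\<in>G. cinner f (\<psi> n) *\<^sub>C \<psi> n) < e"
      using \<open>0 < e\<close> by (simp add: power_less_imp_less_base)
  qed simp
qed

lemma ex_finite_sum_of_cspan_range:
  fixes \<psi> :: "'i \<Rightarrow> 'a::euclidean_space L2"
  assumes "g \<in> cspan (range \<psi>)"
  shows "\<exists>I a. finite I \<and> g = (\<Sum>n\<in>I. a n *\<^sub>C \<psi> n)"
proof -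
  let ?M = "{g. \<exists>I a. finite I \<and> g = (\<Sum>n\<in>I. a n *\<^sub>C \<psi> n)}"
  have "cspan (range \<psi>) \<subseteq> ?M"
  proof (rule L2.span_minimal)
    show "range \<psi> \<subseteq> ?M"
    proof safe
      fix n show "\<exists>I a. finite I \<and> \<psi> n = (\<Sum>n\<in>I. a n *\<^sub>C \<psi> n)"
        by (intro exI[of _ "{n}"] exI[of _ "\<lambda>_. 1"]) (simp add: scaleC_one)
    qed
    show "L2.subspace ?M"
    proof (rule L2.subspaceI; clarify)
      show "\<exists>I a. finite I \<and> 0 = (\<Sum>n\<in>I. a n *\<^sub>C \<psi> n)"
        by (intro exI[of _ "{}"]) simp
    next
      fix I J :: "'i set" and a b assume IJ: "finite I" "finite J"
      have "(\<Sum>n\<in>I. a n *\<^sub>C \<psi> n) = (\<Sum>n\<in>I \<union> J. (if n \<in> I then a n else 0) *\<^sub>C \<psi> n)"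
        using IJ by (intro sum.mono_neutral_cong_left) auto
      moreover have "(\<Sum>n\<in>J. b n *\<^sub>C \<psi> n) = (\<Sum>n\<in>I \<union> J. (if n \<in> J then b n else 0) *\<^sub>C \<psi> n)"
        using IJ by (intro sum.mono_neutral_cong_left) auto
      ultimately have "(\<Sum>n\<in>I. a n *\<^sub>C \<psi> n) + (\<Sum>n\<in>J. b n *\<^sub>C \<psi> n)
          = (\<Sum>n\<in>I \<union> J. ((if n \<in> I then a n else 0) + (if n \<in> J then b n else 0)) *\<^sub>C \<psi> n)"
        by (simp only: scaleC_add_left sum.distrib)
      then show "\<exists>K c. finite K \<and>
          (\<Sum>n\<in>I. a n *\<^sub>C \<psi> n) + (\<Sum>n\<in>J. b n *\<^sub>C \<psi> n) = (\<Sum>n\<in>K. c n *\<^sub>C \<psi> n)"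
        using IJ by (intro exI[of _ "I \<union> J"] exI conjI) auto
    next
      fix c a and I :: "'i set" assume "finite I"
      then show "\<exists>J b. finite J \<and> c *\<^sub>C (\<Sum>n\<in>I. a n *\<^sub>C \<psi> n) = (\<Sum>n\<in>J. b n *\<^sub>C \<psi> n)"
        by (intro exI[of _ I] exI[of _ "\<lambda>n. c * a n"]) (simp add: L2.scale_sum_right scaleC_scaleC)
    qed
  qed
  with assms show ?thesis by blast
qed

text \<open>Some finite combination of the \<open>\<psi> n\<close> is close to \<open>f\<close>; by best approximation the partial Fourier sums
  over all larger index sets are at least as close.\<close>

lemma Fourier_series_has_sum:
  assumes "orthonormal_basis UNIV \<psi>"
  shows "((\<lambda>n. cinner f (\<psi> n) *\<^sub>C \<psi> n) has_sum f) UNIV"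
proof -
  have on: "orthonormal_system UNIV \<psi>" and dense: "closure (cspan (range \<psi>)) = UNIV"
    using assms by (simp_all add: orthonormal_basis_def)
  show ?thesis
    unfolding has_sum_def tendsto_iff eventually_finite_subsets_at_top
  proof (intro allI impI)
    fix e :: real assume "0 < e"
    then obtain g where "g \<in> cspan (range \<psi>)" "dist g f < e"
      using dense by (metis UNIV_I closure_approachable)
    then obtain I a where I: "finite I" and near: "norm (f - (\<Sum>n\<in>I. a n *\<^sub>C \<psi> n)) < e"
      using ex_finite_sum_of_cspan_range[of g \<psi>] by (auto simp: dist_norm norm_minus_commute)
    have "dist (\<Sum>n\<in>J. cinner f (\<psi> n) *\<^sub>C \<psi> n) f < e" if J: "finite J" "I \<subseteq> J" for J
    proof -
      let ?a = "\<lambda>n. if n \<in> I then a n else 0"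
      have "(\<Sum>n\<in>J. ?a n *\<^sub>C \<psi> n) = (\<Sum>n\<in>I. a n *\<^sub>C \<psi> n)"
        using J by (intro sum.mono_neutral_cong_right) auto
      moreover have "(norm (f - (\<Sum>n\<in>J. cinner f (\<psi> n) *\<^sub>C \<psi> n)))\<^sup>2
          \<le> (norm (f - (\<Sum>n\<in>J. ?a n *\<^sub>C \<psi> n)))\<^sup>2"
        unfolding norm_power2_minus_orthonormal_sum[OF on J(1), of f ?a] by (simp add: sum_nonneg)
      ultimately have "(norm (f - (\<Sum>n\<in>J. cinner f (\<psi> n) *\<^sub>C \<psi> n)))\<^sup>2
          \<le> (norm (f - (\<Sum>n\<in>I. a n *\<^sub>C \<psi> n)))\<^sup>2"
        by (simp only:)
      then have "norm (f - (\<Sum>n\<in>J. cinner f (\<psi> n) *\<^sub>C \<psi> n)) \<le> norm (f - (\<Sum>n\<in>I. a n *\<^sub>C \<psi> n))"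
        by (rule power2_le_imp_le) simp
      then show ?thesis
        using near by (simp add: dist_norm norm_minus_commute)
    qed
    then show "\<exists>X. finite X \<and> X \<subseteq> UNIV \<and> (\<forall>Y. finite Y \<and> X \<subseteq> Y \<and> Y \<subseteq> UNIV \<longrightarrow>
        dist (\<Sum>n\<in>Y. cinner f (\<psi> n) *\<^sub>C \<psi> n) f < e)"
      using I by (intro exI[of _ I]) auto
  qed
qed

lemma bounded_clinear_has_sum:
  assumes "bounded_clinear A" "(f has_sum s) I"
  shows "((\<lambda>i. A (f i)) has_sum A s) I"
proof -
  have "bounded_linear A"
    using assms(1) by (simp add: bounded_clinear_def)
  then show ?thesis
    using has_sum_bounded_linear[OF _ assms(2), of A] by (simp only: o_def)
qed

lemma eq_zero_of_orthogonal_to_basis: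
  fixes \<psi> :: "'i \<Rightarrow> 'a::euclidean_space L2"
  assumes "orthonormal_basis UNIV \<psi>" "\<And>n. cinner f (\<psi> n) = 0"
  shows "f = 0"
proof -
  have "((\<lambda>n::'i. 0) has_sum f) UNIV"
    using Fourier_series_has_sum[OF assms(1), of f] by (simp add: assms(2))
  then show ?thesis
    by (rule has_sum_unique[OF _ has_sum_0]) simp
qed

text \<open>The projection is the sum of the Fourier series of \<open>f\<close>. This is where completeness enters.\<close>

lemma ex_orthogonal_projection_onto_span:
  assumes on: "orthonormal_system UNIV \<psi>"
  obtains p where "p \<in> closure (cspan (range \<psi>))" "\<And>m. cinner (f - p) (\<psi> m) = 0"
proof -
  obtain p where p: "((\<lambda>n. cinner f (\<psi> n) *\<^sub>C \<psi> n) has_sum p) UNIV"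
    using Fourier_series_summable[OF on] unfolding summable_on_def by blast
  have "p \<in> closure (cspan (range \<psi>))"
  proof (rule Lim_in_closed_set[OF closed_closure _ _ p[unfolded has_sum_def]])
    have "(\<Sum>n\<in>I. cinner f (\<psi> n) *\<^sub>C \<psi> n) \<in> closure (cspan (range \<psi>))" for I
      using L2.span_sum[of I] by (intro subsetD[OF closure_subset] L2.span_sum L2.span_scale L2.span_base) auto
    then show "\<forall>\<^sub>F I in finite_subsets_at_top UNIV.
        (\<Sum>n\<in>I. cinner f (\<psi> n) *\<^sub>C \<psi> n) \<in> closure (cspan (range \<psi>))"
      by simp
  qed simp
  moreover have "cinner (f - p) (\<psi> m) = 0" for m
  proof -
    have "bounded_linear (\<lambda>g. cinner g (\<psi> m))"
      by (rule bounded_bilinear.bounded_linear_left[OF bounded_bilinear_cinner])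
    from has_sum_bounded_linear[OF this p]
    have "((\<lambda>n. cinner (cinner f (\<psi> n) *\<^sub>C \<psi> n) (\<psi> m)) has_sum cinner p (\<psi> m)) UNIV"
      by (simp only: o_def)
    then have "((\<lambda>n. cinner (cinner f (\<psi> n) *\<^sub>C \<psi> n) (\<psi> m)) has_sum cinner p (\<psi> m)) {m}"
      by (rule has_sum_cong_neutral[THEN iffD1, rotated -1])
         (use on in \<open>auto simp: cinner_simps orthonormal_system_def\<close>)
    then have "((\<lambda>n. cinner f (\<psi> m)) has_sum cinner p (\<psi> m)) {m}"
      by (rule has_sum_cong[THEN iffD1, rotated])
         (use on in \<open>auto simp: cinner_simps orthonormal_system_def\<close>)
    then have "cinner p (\<psi> m) = cinner f (\<psi> m)"
      using has_sum_finite[of "{m}" "\<lambda>n. cinner f (\<psi> m)"] has_sum_unique by fastforce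
    then show ?thesis by (simp add: cinner_simps)
  qed
  ultimately show ?thesis by (rule that)
qed

text \<open>Let \<open>p\<close> be the projection of \<open>f\<close> onto the closed span of the \<open>\<psi> n\<close>. The spectral expansion of \<open>T\<close> only
  involves inner products with the \<open>\<psi> n\<close>, so \<open>T\<close> vanishes on \<open>f - p\<close>. Thus \<open>f - p\<close> is an eigenfunction for
  the eigenvalue zero, and it lies in the closed span because the \<open>\<psi> n\<close> exhaust all eigenfunctions.\<close>

lemma orthonormal_basis_of_eigenfunctions:
  fixes \<psi> :: "'i \<Rightarrow> 'a::euclidean_space L2"
  assumes "eigenfunctions T \<psi> \<mu>" "bounded_clinear T"
  shows "orthonormal_basis UNIV \<psi>"
proof -
  have on: "orthonormal_system UNIV \<psi>"
    and diag: "\<And>f. ((\<lambda>n. \<mu> n *\<^sub>C rank_one (\<psi> n) (\<psi> n) f) has_sum T f) UNIV"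
    and total: "\<And>c f. T f = c *\<^sub>C f \<Longrightarrow> f \<in> closure (cspan (range \<psi>))"
    using assms(1) unfolding eigenfunctions_def by blast+
  have sub: "L2.subspace (closure (cspan (range \<psi>)))"
    by (rule complex_subspace_closure[OF L2.subspace_span])
  have "f \<in> closure (cspan (range \<psi>))" for f
  proof -
    obtain p where p: "p \<in> closure (cspan (range \<psi>))" "\<And>m. cinner (f - p) (\<psi> m) = 0"
      using ex_orthogonal_projection_onto_span[OF on] by blast
    have "((\<lambda>n::'i. 0) has_sum T (f - p)) UNIV"
      using diag[of "f - p"] by (simp add: rank_one_def p(2))
    then have "T (f - p) = 0"
      by (rule has_sum_unique[OF _ has_sum_0]) simp
    then have "T (f - p) = 0 *\<^sub>C (f - p)"
      by simp
    then have "p + (f - p) \<in> closure (cspan (range \<psi>))"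
      by (intro L2.subspace_add[OF sub] p(1) total)
    then show ?thesis by simp
  qed
  then show ?thesis
    using on by (auto simp: orthonormal_basis_def)
qed

text \<open>The vector \<open>T (\<psi> n) - c n *\<^sub>C \<psi> n\<close> is orthogonal to the whole basis, hence zero. Applying \<open>T\<close> termwise to
  the Fourier series of \<open>f\<close> gives the spectral expansion.\<close>

lemma eigenfunctions_of_diagonal_matrix:
  assumes onb: "orthonormal_basis UNIV \<psi>" and T: "bounded_clinear T"
    and diag: "\<And>n m. cinner (T (\<psi> n)) (\<psi> m) = (if n = m then c n else 0)"
  shows "eigenfunctions T \<psi> c"
proof -
  have on: "orthonormal_system UNIV \<psi>" and dense: "closure (cspan (range \<psi>)) = UNIV"
    using onb by (simp_all add: orthonormal_basis_def)
  have eigen: "T (\<psi> n) = c n *\<^sub>C \<psi> n" for n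
  proof -
    have "cinner (T (\<psi> n) - c n *\<^sub>C \<psi> n) (\<psi> m) = 0" for m
      using on by (simp add: cinner_simps diag orthonormal_system_def)
    then have "T (\<psi> n) - c n *\<^sub>C \<psi> n = 0"
      by (rule eq_zero_of_orthogonal_to_basis[OF onb])
    then show ?thesis by simp
  qed
  have "((\<lambda>n. c n *\<^sub>C rank_one (\<psi> n) (\<psi> n) f) has_sum T f) UNIV" for f
  proof -
    have "T (cinner f (\<psi> n) *\<^sub>C \<psi> n) = c n *\<^sub>C rank_one (\<psi> n) (\<psi> n) f" for n
      using T by (simp add: bounded_clinear_def eigen rank_one_def scaleC_scaleC mult.commute)
    then show ?thesis
      using bounded_clinear_has_sum[OF T Fourier_series_has_sum[OF onb, of f]] by simp
  qed
  then show ?thesis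
    using on eigen dense by (simp add: eigenfunctions_def)
qed

lemma eigenfunctions_matrix:
  assumes "eigenfunctions T \<psi> \<mu>"
  shows "cinner (T (\<psi> n)) (\<psi> m) = (if n = m then \<mu> n else 0)"
  using assms by (auto simp: eigenfunctions_def orthonormal_system_def cinner_simps)


section \<open>Schwartz functions\<close>

lemma power_le_fact_mult_exp:
  fixes y :: real
  assumes "0 \<le> y"
  shows "y ^ n \<le> fact n * exp y"
proof -
  have "(\<Sum>k\<in>{n}. y ^ k /\<^sub>R fact k) \<le> (\<Sum>k. y ^ k /\<^sub>R fact k)"
    using assms by (intro sum_le_suminf summable_exp_generic) auto
  then have "y ^ n / fact n \<le> exp y"
    by (simp add: exp_def field_simps)
  then show ?thesis
    by (simp add: field_simps)
qed

lemma real_polynomial_function_derivative: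
  assumes "real_polynomial_function p"
  shows "\<exists>D. (\<forall>x. (p has_derivative D x) (at x)) \<and> (\<forall>b. real_polynomial_function (\<lambda>x. D x b))"
  using assms
proof induction
  case (linear f)
  then show ?case
    by (intro exI[of _ "\<lambda>x. f"]) (auto intro: bounded_linear_imp_has_derivative)
next
  case (const c)
  show ?case
    by (intro exI[of _ "\<lambda>x h. 0"]) auto
next
  case (add f g)
  then obtain D E where "\<And>x. (f has_derivative D x) (at x)" "\<And>b. real_polynomial_function (\<lambda>x. D x b)"
    "\<And>x. (g has_derivative E x) (at x)" "\<And>b. real_polynomial_function (\<lambda>x. E x b)"
    by metis
  then show ?case
    by (intro exI[of _ "\<lambda>x h. D x h + E x h"]) (auto intro: has_derivative_add)
next
  case (mult f g)
  then obtain D E where "\<And>x. (f has_derivative D x) (at x)" "\<And>b. real_polynomial_function (\<lambda>x. D x b)"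
    "\<And>x. (g has_derivative E x) (at x)" "\<And>b. real_polynomial_function (\<lambda>x. E x b)"
    by metis
  with mult.hyps show ?case
    by (intro exI[of _ "\<lambda>x h. f x * E x h + D x h * g x"] conjI allI has_derivative_mult
        real_polynomial_function.intros(3,4)) auto
qed

lemma real_polynomial_function_growth:
  assumes "real_polynomial_function p"
  shows "\<exists>C k. \<forall>x. \<bar>p x\<bar> \<le> C * (1 + norm x) ^ k"
proof -
  have pow: "(1 + norm x) ^ k \<le> (1 + norm x) ^ (k + l)" for x :: 'a and k l :: nat
    by (intro power_increasing) auto
  have "\<exists>C k. 0 \<le> C \<and> (\<forall>x. \<bar>p x\<bar> \<le> C * (1 + norm x) ^ k)"
    using assms
  proof induction
    case (linear f)
    then obtain K where K: "0 \<le> K" "\<And>x. norm (f x) \<le> norm x * K"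
      using bounded_linear.nonneg_bounded by blast
    have "\<bar>f x\<bar> \<le> K * (1 + norm x) ^ 1" for x
      using K(2)[of x] K(1) by (simp add: algebra_simps)
    with K(1) show ?case by blast
  next
    case (const c)
    show ?case
      by (intro exI[of _ "\<bar>c\<bar>"] exI[of _ 0]) auto
  next
    case (add f g)
    then obtain C k D l where *: "0 \<le> C" "\<And>x. \<bar>f x\<bar> \<le> C * (1 + norm x) ^ k"
      "0 \<le> D" "\<And>x. \<bar>g x\<bar> \<le> D * (1 + norm x) ^ l"
      by metis
    have "\<bar>f x + g x\<bar> \<le> (C + D) * (1 + norm x) ^ (k + l)" for x
    proof -
      have "\<bar>f x + g x\<bar> \<le> C * (1 + norm x) ^ k + D * (1 + norm x) ^ l"
        using *(2)[of x] *(4)[of x] by linarith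
      also have "\<dots> \<le> C * (1 + norm x) ^ (k + l) + D * (1 + norm x) ^ (k + l)"
        using pow[of x k l] pow[of x l k] *(1,3)
        by (intro add_mono mult_left_mono) (auto simp: add.commute)
      finally show ?thesis by (simp add: algebra_simps)
    qed
    with *(1,3) show ?case
      by (intro exI[of _ "C + D"] exI[of _ "k + l"]) auto
  next
    case (mult f g)
    then obtain C k D l where *: "0 \<le> C" "\<And>x. \<bar>f x\<bar> \<le> C * (1 + norm x) ^ k"
      "0 \<le> D" "\<And>x. \<bar>g x\<bar> \<le> D * (1 + norm x) ^ l"
      by metis
    have "\<bar>f x * g x\<bar> \<le> (C * D) * (1 + norm x) ^ (k + l)" for x
      using mult_mono[OF *(2)[of x] *(4)[of x]] *(1) by (simp add: abs_mult power_add mult_ac)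
    with *(1,3) show ?case
      by (intro exI[of _ "C * D"] exI[of _ "k + l"]) auto
  qed
  then show ?thesis by blast
qed

text \<open>For fixed \<open>q\<close>, the functions \<open>p exp (- q)\<close> with polynomial \<open>p\<close> are closed under directional derivatives:
  \<open>p\<close> becomes \<open>p' - p q'\<close>. Each of them decays faster than any power, since \<open>exp (- q)\<close> is bounded by a
  multiple of \<open>exp (- \<bar>x\<bar>)\<close>.\<close>

lemma schwartz_polynomial_exp:
  fixes p q :: "'b::euclidean_space \<Rightarrow> real"
  assumes p: "real_polynomial_function p" and q: "real_polynomial_function q"
    and coercive: "\<And>x. norm x \<le> q x + K"
  shows "schwartz (\<lambda>x. complex_of_real (p x * exp (- q x)))"
proof -
  let ?f = "\<lambda>p x. complex_of_real (p x * exp (- q x))"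
  obtain Dq where Dq: "\<And>x. (q has_derivative Dq x) (at x)"
    "\<And>b. real_polynomial_function (\<lambda>x. Dq x b)"
    using real_polynomial_function_derivative[OF q] by blast
  have deriv: "(\<forall>x. ?f p differentiable at x) \<and>
      (\<exists>p'. real_polynomial_function p' \<and> (\<lambda>x. frechet_derivative (?f p) (at x) b) = ?f p')"
    if p: "real_polynomial_function p" for p b
  proof -
    obtain Dp where Dp: "\<And>x. (p has_derivative Dp x) (at x)"
      "\<And>b. real_polynomial_function (\<lambda>x. Dp x b)"
      using real_polynomial_function_derivative[OF p] by blast
    have D: "(?f p has_derivative (\<lambda>h. complex_of_real ((Dp x h - p x * Dq x h) * exp (- q x)))) (at x)" for x
      by (auto intro!: derivative_eq_intros Dp Dq simp: algebra_simps)
    have "(\<lambda>x. frechet_derivative (?f p) (at x) b) = ?f (\<lambda>x. Dp x b - p x * Dq x b)"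
      by (intro ext) (simp only: frechet_derivative_at[OF D, symmetric])
    moreover have "real_polynomial_function (\<lambda>x. Dp x b - p x * Dq x b)"
      using Dp Dq p by (intro real_polynomial_function_diff real_polynomial_function.intros(4))
    ultimately show ?thesis
      using D by (auto simp: differentiable_def)
  qed
  have bound: "bounded (range (\<lambda>x. norm x ^ k *\<^sub>R ?f p x))" if p: "real_polynomial_function p" for p k
  proof -
    obtain C m where C: "\<And>x. \<bar>p x\<bar> \<le> C * (1 + norm x) ^ m"
      using real_polynomial_function_growth[OF p] by blast
    have "0 \<le> C"
      using C[of 0] by (simp add: order_trans[OF abs_ge_zero])
    have "norm (norm x ^ k *\<^sub>R ?f p x) \<le> C * (fact (k + m) * exp (1 + K))" for x
    proof -
      have "norm x ^ k * \<bar>p x\<bar> \<le> (1 + norm x) ^ k * (C * (1 + norm x) ^ m)"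
        by (intro mult_mono power_mono C) auto
      also have "\<dots> = C * (1 + norm x) ^ (k + m)"
        by (simp add: power_add mult_ac)
      also have "\<dots> \<le> C * (fact (k + m) * exp (1 + norm x))"
        using \<open>0 \<le> C\<close> by (intro mult_left_mono power_le_fact_mult_exp) auto
      finally have "norm x ^ k * \<bar>p x\<bar> * exp (- q x) \<le> C * (fact (k + m) * exp (1 + norm x)) * exp (- q x)"
        by (intro mult_right_mono) auto
      also have "\<dots> = C * (fact (k + m) * exp (1 + norm x - q x))"
        by (simp add: exp_diff exp_minus field_simps)
      also have "\<dots> \<le> C * (fact (k + m) * exp (1 + K))"
        using \<open>0 \<le> C\<close> coercive[of x] by (intro mult_left_mono) auto
      finally show ?thesis
        by (simp add: abs_mult mult_ac norm_mult)
    qed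
    then show ?thesis
      unfolding bounded_iff by blast
  qed
  have iter: "\<exists>p'. real_polynomial_function p' \<and> iterated_deriv bs (?f p) = ?f p'" for bs
  proof (induction bs)
    case Nil
    show ?case
      by (intro exI[of _ p] conjI p iterated_deriv.simps(1))
  next
    case (Cons b bs)
    then obtain p' where p': "real_polynomial_function p'" "iterated_deriv bs (?f p) = ?f p'"
      by blast
    show ?case
      unfolding iterated_deriv.simps p'(2) using deriv[OF p'(1), of b] by (rule conjunct2)
  qed
  show ?thesis
    unfolding schwartz_def
  proof (intro ballI)
    fix bs :: "'b list"
    obtain p' where p': "real_polynomial_function p'" "iterated_deriv bs (?f p) = ?f p'"
      using iter by blast
    show "(\<forall>x. iterated_deriv bs (?f p) differentiable at x) \<and>
        (\<forall>k. bounded (range (\<lambda>x. norm x ^ k *\<^sub>R iterated_deriv bs (?f p) x)))"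
      unfolding p'(2) using deriv[OF p'(1)] bound[OF p'(1)] by (intro conjI allI) auto
  qed
qed

lemma iterated_deriv_add:
  assumes "schwartz f" "schwartz g" "bs \<in> lists Basis"
  shows "iterated_deriv bs (\<lambda>x. f x + g x) = (\<lambda>x. iterated_deriv bs f x + iterated_deriv bs g x)"
  using assms(3)
proof (induction bs)
  case (Cons b bs)
  have "iterated_deriv bs f differentiable at x" "iterated_deriv bs g differentiable at x" for x
    using assms(1,2) Cons.hyps by (auto simp: schwartz_def)
  then have D: "((\<lambda>x. iterated_deriv bs f x + iterated_deriv bs g x) has_derivative
      (\<lambda>h. frechet_derivative (iterated_deriv bs f) (at x) h + frechet_derivative (iterated_deriv bs g) (at x) h)) (at x)" for x
    by (intro has_derivative_add) (auto simp: frechet_derivative_works)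
  show ?case
    unfolding iterated_deriv.simps Cons.IH by (intro ext) (simp only: frechet_derivative_at[OF D, symmetric])
qed simp

lemma schwartz_add:
  assumes "schwartz f" "schwartz g"
  shows "schwartz (\<lambda>x. f x + g x)"
  using assms unfolding schwartz_def
  by (auto simp: iterated_deriv_add[OF assms] scaleR_add_right intro!: differentiable_add bounded_plus_comp)

lemma iterated_deriv_scale:
  assumes "schwartz f" "bs \<in> lists Basis"
  shows "iterated_deriv bs (\<lambda>x. c * f x) = (\<lambda>x. c * iterated_deriv bs f x)"
  using assms(2)
proof (induction bs)
  case (Cons b bs)
  have "iterated_deriv bs f differentiable at x" for x
    using assms(1) Cons.hyps by (auto simp: schwartz_def)
  then have D: "((\<lambda>x. c * iterated_deriv bs f x) has_derivative
      (\<lambda>h. c * frechet_derivative (iterated_deriv bs f) (at x) h)) (at x)" for x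
    by (intro has_derivative_mult_right) (auto simp: frechet_derivative_works)
  show ?case
    unfolding iterated_deriv.simps Cons.IH by (intro ext) (simp only: frechet_derivative_at[OF D, symmetric])
qed simp

lemma schwartz_scale:
  assumes "schwartz f"
  shows "schwartz (\<lambda>x. c * f x)"
  unfolding schwartz_def
proof (intro ballI conjI allI)
  fix bs :: "'a list" and k :: nat and x
  assume bs: "bs \<in> lists Basis"
  show "iterated_deriv bs (\<lambda>x. c * f x) differentiable at x"
    using assms bs by (auto simp: schwartz_def iterated_deriv_scale intro!: differentiable_mult)
  have "bounded (range (\<lambda>x. norm x ^ k *\<^sub>R iterated_deriv bs f x))"
    using assms bs by (auto simp: schwartz_def)
  then have "bounded ((*) c ` range (\<lambda>x. norm x ^ k *\<^sub>R iterated_deriv bs f x))"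
    by (rule bounded_linear_image[OF _ bounded_linear_mult_right])
  then show "bounded (range (\<lambda>x. norm x ^ k *\<^sub>R iterated_deriv bs (\<lambda>x. c * f x) x))"
    by (simp add: iterated_deriv_scale assms bs image_image)
qed


section \<open>Density of the Schwartz functions\<close>

lemma inner_One_Basis: "i \<in> Basis \<Longrightarrow> One \<bullet> i = 1"
  using inner_sum_left_Basis[of i "\<lambda>_. 1"] by simp

text \<open>As \<open>n\<close> grows, this tends to the indicator function of the open box with centre \<open>m\<close> and half side lengths
  \<open>s \<bullet> i\<close>, except on the boundary. Being the exponential of a polynomial it is easily seen to be a Schwartz
  function, which spares the construction of smooth functions with compact support. For \<open>n = 1\<close> it is a
  Gaussian.\<close>

definition box_bump :: "'b::euclidean_space \<Rightarrow> 'b \<Rightarrow> nat \<Rightarrow> 'b \<Rightarrow> real" where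
  "box_bump m s n x = exp (- (\<Sum>i\<in>Basis. (((x \<bullet> i - m \<bullet> i) / (s \<bullet> i))\<^sup>2) ^ n))"

lemma le_power_add_one:
  fixes u :: real
  assumes "0 \<le> u" "1 \<le> n"
  shows "u \<le> u ^ n + 1"
proof (cases "u \<le> 1")
  case True
  then show ?thesis using zero_le_power[OF assms(1), of n] by linarith
next
  case False
  then show ?thesis using self_le_power[of u n] assms by simp
qed

lemma schwartz_box_bump:
  fixes m s :: "'b::euclidean_space"
  assumes s: "\<And>i. i \<in> Basis \<Longrightarrow> 0 < s \<bullet> i" and n: "1 \<le> n"
  shows "schwartz (\<lambda>x. complex_of_real (box_bump m s n x))"
proof -
  let ?y = "\<lambda>i x. (x \<bullet> i - m \<bullet> i) / (s \<bullet> i)"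
  let ?q = "\<lambda>x. \<Sum>i\<in>Basis. ((?y i x)\<^sup>2) ^ n"
  have poly_q: "real_polynomial_function ?q"
    by (intro real_polynomial_function_sum real_polynomial_function_power real_polynomial_function_divide
        real_polynomial_function_diff real_polynomial_function.intros(1,2) bounded_linear_inner_left)
       auto
  have "norm x \<le> ?q x + (\<Sum>i\<in>Basis. \<bar>m \<bullet> i\<bar> + (s \<bullet> i)\<^sup>2 + 1)" for x
  proof -
    have "\<bar>x \<bullet> i\<bar> \<le> ((?y i x)\<^sup>2) ^ n + (\<bar>m \<bullet> i\<bar> + (s \<bullet> i)\<^sup>2 + 1)" if i: "i \<in> Basis" for i
    proof -
      have "\<bar>u * v\<bar> \<le> u\<^sup>2 + v\<^sup>2" for u v :: real
      proof -
        have "0 \<le> (\<bar>u\<bar> - \<bar>v\<bar>)\<^sup>2" "0 \<le> \<bar>u * v\<bar>" by simp_all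
        then show ?thesis unfolding power2_diff power2_abs abs_mult by linarith
      qed
      from this[of "s \<bullet> i" "?y i x"]
      have "\<bar>x \<bullet> i - m \<bullet> i\<bar> \<le> (s \<bullet> i)\<^sup>2 + (?y i x)\<^sup>2"
        using s[OF i] by simp
      then show ?thesis
        using le_power_add_one[OF zero_le_power2[of "?y i x"] n] by linarith
    qed
    then have "(\<Sum>i\<in>Basis. \<bar>x \<bullet> i\<bar>) \<le> ?q x + (\<Sum>i\<in>Basis. \<bar>m \<bullet> i\<bar> + (s \<bullet> i)\<^sup>2 + 1)"
      unfolding sum.distrib[symmetric, of "\<lambda>i. ((?y i x)\<^sup>2) ^ n"] by (rule sum_mono)
    then show ?thesis
      using norm_le_l1[of x] by linarith
  qed
  from schwartz_polynomial_exp[OF real_polynomial_function.intros(2)[of 1] poly_q this]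
  show ?thesis by (simp add: box_bump_def)
qed

lemma integrable_lborel_prod:
  fixes f :: "'b::euclidean_space \<Rightarrow> real \<Rightarrow> real"
  assumes f: "\<And>i. i \<in> Basis \<Longrightarrow> integrable lborel (f i)" and nonneg: "\<And>i t. 0 \<le> f i t"
  shows "integrable lborel (\<lambda>x. \<Prod>i\<in>Basis. f i (x \<bullet> i))"
proof (rule integrableI_nonneg)
  have [measurable]: "f i \<in> borel_measurable borel" if "i \<in> Basis" for i
    using borel_measurable_integrable[OF f[OF that]] by simp
  show "(\<lambda>x. \<Prod>i\<in>Basis. f i (x \<bullet> i)) \<in> borel_measurable lborel"
    by measurable
  show "AE x in lborel. 0 \<le> (\<Prod>i\<in>Basis. f i (x \<bullet> i))"
    using nonneg by (simp add: prod_nonneg)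
  have "(\<integral>\<^sup>+x. ennreal (\<Prod>i\<in>Basis. f i (x \<bullet> i)) \<partial>lborel) = (\<integral>\<^sup>+x. (\<Prod>i\<in>Basis. ennreal (f i (x \<bullet> i))) \<partial>lborel)"
    using nonneg by (simp add: prod_ennreal)
  also have "\<dots> = (\<Prod>i\<in>Basis. \<integral>\<^sup>+t. ennreal (f i t) \<partial>lborel)"
    by (rule nn_integral_lborel_prod) auto
  also have "\<dots> < \<infinity>"
    using f nonneg by (auto simp: ennreal_prod_eq_top less_top[symmetric] nn_integral_eq_integral)
  finally show "(\<integral>\<^sup>+x. ennreal (\<Prod>i\<in>Basis. f i (x \<bullet> i)) \<partial>lborel) < \<infinity>" .
qed

text \<open>The square is a product over the coordinates of multiples of normal densities with variance
  \<open>(s \<bullet> i / 2)\<^sup>2\<close>.\<close>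

lemma square_integrable_gaussian:
  fixes m s :: "'b::euclidean_space"
  assumes s: "\<And>i. i \<in> Basis \<Longrightarrow> 0 < s \<bullet> i"
  shows "square_integrable (\<lambda>x. complex_of_real (exp (\<Sum>i\<in>Basis. 1 - ((x \<bullet> i - m \<bullet> i) / (s \<bullet> i))\<^sup>2)))"
  unfolding square_integrable_def
proof
  let ?f = "\<lambda>i t. exp (2 * (1 - ((t - m \<bullet> i) / (s \<bullet> i))\<^sup>2))"
  have "integrable lborel (?f i)" if i: "i \<in> Basis" for i
  proof -
    have "?f i t = exp 2 * (sqrt (2 * pi * (s \<bullet> i / 2)\<^sup>2) * normal_density (m \<bullet> i) (s \<bullet> i / 2) t)" for t
    proof -
      have "- (t - m \<bullet> i)\<^sup>2 / (2 * (s \<bullet> i / 2)\<^sup>2) = - 2 * ((t - m \<bullet> i) / (s \<bullet> i))\<^sup>2"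
        by (simp add: power_divide)
      moreover have "sqrt (2 * pi * (s \<bullet> i / 2)\<^sup>2) \<noteq> 0"
        using s[OF i] by simp
      ultimately show ?thesis
        unfolding normal_density_def by (simp add: exp_add[symmetric] algebra_simps)
    qed
    then have "?f i = (\<lambda>t. exp 2 * (sqrt (2 * pi * (s \<bullet> i / 2)\<^sup>2) * normal_density (m \<bullet> i) (s \<bullet> i / 2) t))"
      by (rule ext)
    then show ?thesis
      using s[OF i] by (simp only:) (intro integrable_mult_right integrable_normal_density, simp)
  qed
  then have "integrable lborel (\<lambda>x. \<Prod>i\<in>Basis. ?f i (x \<bullet> i))"
    by (rule integrable_lborel_prod) auto
  moreover have "(cmod (complex_of_real (exp (\<Sum>i\<in>Basis. 1 - ((x \<bullet> i - m \<bullet> i) / (s \<bullet> i))\<^sup>2))))\<^sup>2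
      = (\<Prod>i\<in>Basis. ?f i (x \<bullet> i))" for x :: 'b
    unfolding norm_of_real power2_abs exp_double[symmetric]
    by (simp only: exp_sum[symmetric] finite_Basis sum_distrib_left)
  ultimately show "integrable lborel (\<lambda>x. (cmod (complex_of_real
      (exp (\<Sum>i\<in>Basis. 1 - ((x \<bullet> i - m \<bullet> i) / (s \<bullet> i))\<^sup>2))))\<^sup>2)"
    by (simp only:)
qed (auto intro!: borel_measurable_continuous_onI continuous_intros)

text \<open>A square-integrable bound that is uniform in \<open>n\<close>, from \<open>u \<le> u\<^sup>n + 1\<close> for \<open>u \<ge> 0\<close>.\<close>

lemma box_bump_le_gaussian:
  assumes "1 \<le> n"
  shows "box_bump m s n x \<le> exp (\<Sum>i\<in>Basis. 1 - ((x \<bullet> i - m \<bullet> i) / (s \<bullet> i))\<^sup>2)"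
proof -
  have "- (\<Sum>i\<in>Basis. (((x \<bullet> i - m \<bullet> i) / (s \<bullet> i))\<^sup>2) ^ n) \<le> (\<Sum>i\<in>Basis. 1 - ((x \<bullet> i - m \<bullet> i) / (s \<bullet> i))\<^sup>2)"
    unfolding sum_negf[symmetric]
  proof (rule sum_mono)
    fix i
    show "- ((((x \<bullet> i - m \<bullet> i) / (s \<bullet> i))\<^sup>2) ^ n) \<le> 1 - ((x \<bullet> i - m \<bullet> i) / (s \<bullet> i))\<^sup>2"
      using le_power_add_one[OF zero_le_power2 assms, of "(x \<bullet> i - m \<bullet> i) / (s \<bullet> i)"] by linarith
  qed
  then show ?thesis by (simp add: box_bump_def)
qed

lemma tendsto_box_bump_inside:
  assumes "\<And>i. i \<in> Basis \<Longrightarrow> \<bar>(x \<bullet> i - m \<bullet> i) / (s \<bullet> i)\<bar> < 1"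
  shows "(\<lambda>n. box_bump m s n x) \<longlonglongrightarrow> 1"
proof -
  have "(\<lambda>n. (((x \<bullet> i - m \<bullet> i) / (s \<bullet> i))\<^sup>2) ^ n) \<longlonglongrightarrow> 0" if "i \<in> Basis" for i
    using assms[OF that] unfolding abs_square_less_1[symmetric] by (intro LIMSEQ_power_zero) simp
  then have "(\<lambda>n. box_bump m s n x) \<longlonglongrightarrow> exp (- (\<Sum>i\<in>(Basis :: 'a set). 0))"
    unfolding box_bump_def by (intro tendsto_exp tendsto_minus tendsto_sum)
  then show ?thesis by simp
qed

lemma tendsto_box_bump_outside:
  assumes i: "i \<in> Basis" "1 < \<bar>(x \<bullet> i - m \<bullet> i) / (s \<bullet> i)\<bar>"
  shows "(\<lambda>n. box_bump m s n x) \<longlonglongrightarrow> 0"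
proof -
  let ?y = "\<lambda>i. (x \<bullet> i - m \<bullet> i) / (s \<bullet> i)"
  have "filterlim (\<lambda>n. ((?y i)\<^sup>2) ^ n) at_top sequentially"
  proof (rule filterlim_at_infinity_imp_filterlim_at_top[OF filterlim_realpow_sequentially_gt1])
    have "1 < \<bar>?y i\<bar>\<^sup>2"
      using i(2) by (intro one_less_power) auto
    then show "1 < norm ((?y i)\<^sup>2)"
      by (simp only: real_norm_def abs_power2 power2_abs)
    have pos: "0 < (?y i)\<^sup>2"
      unfolding zero_less_power2
    proof
      assume "?y i = 0"
      with i(2) show False by (simp only: abs_zero not_one_less_zero)
    qed
    show "\<forall>\<^sub>F n in sequentially. 0 < ((?y i)\<^sup>2) ^ n"
      by (rule always_eventually, rule allI, rule zero_less_power, rule pos)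
  qed
  then have "filterlim (\<lambda>n. \<Sum>i\<in>Basis. ((?y i)\<^sup>2) ^ n) at_top sequentially"
    by (rule filterlim_at_top_mono) (auto intro!: always_eventually member_le_sum i(1))
  then have "filterlim (\<lambda>n. - (\<Sum>i\<in>Basis. ((?y i)\<^sup>2) ^ n)) at_bot sequentially"
    by (simp add: filterlim_uminus_at_bot)
  then show ?thesis
    unfolding box_bump_def by (rule filterlim_compose[OF exp_at_bot])
qed

lemma in_closure_of_tendsto:
  fixes X :: "nat \<Rightarrow> 'a::metric_space"
  assumes "\<And>n. X n \<in> S" "X \<longlonglongrightarrow> l"
  shows "l \<in> closure S"
  using assms unfolding closure_sequential by (intro exI[of _ X]) auto

lemma subspace_schwartz_L2: "L2.subspace (schwartz_L2 :: 'a::euclidean_space L2 set)"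
proof (rule L2.subspaceI)
  have zero: "schwartz (\<lambda>x::'a. 0)"
  proof -
    have "schwartz (\<lambda>x::'a. complex_of_real (box_bump 0 One 1 x))"
      by (rule schwartz_box_bump) (simp_all add: inner_One_Basis)
    from schwartz_scale[OF this, of 0] show ?thesis by simp
  qed
  show "0 \<in> (schwartz_L2 :: 'a L2 set)"
    unfolding schwartz_L2_def zero_L2_def
    by (auto intro!: exI[of _ "\<lambda>_. 0"] zero rep_L2_abs_L2 square_integrable_zero)
next
  fix f g :: "'a L2" assume "f \<in> schwartz_L2" "g \<in> schwartz_L2"
  then obtain u v where uv: "schwartz u" "AE t in lborel. rep_L2 f t = u t"
    "schwartz v" "AE t in lborel. rep_L2 g t = v t"
    unfolding schwartz_L2_def by auto
  have "AE t in lborel. rep_L2 (abs_L2 (\<lambda>t. rep_L2 f t + rep_L2 g t)) t = rep_L2 f t + rep_L2 g t"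
    by (intro rep_L2_abs_L2 square_integrable_add square_integrable_rep_L2)
  then have "AE t in lborel. rep_L2 (abs_L2 (rep_L2 f) + abs_L2 (rep_L2 g)) t = u t + v t"
    using uv(2,4) unfolding abs_L2_add[OF square_integrable_rep_L2 square_integrable_rep_L2]
    by eventually_elim (simp only:)
  then show "f + g \<in> schwartz_L2"
    unfolding abs_L2_rep_L2 schwartz_L2_def using schwartz_add[OF uv(1,3)] by blast
next
  fix c and f :: "'a L2" assume "f \<in> schwartz_L2"
  then obtain u where u: "schwartz u" "AE t in lborel. rep_L2 f t = u t"
    unfolding schwartz_L2_def by auto
  have "AE t in lborel. rep_L2 (abs_L2 (\<lambda>t. c * rep_L2 f t)) t = c * rep_L2 f t"
    by (intro rep_L2_abs_L2 square_integrable_scale square_integrable_rep_L2)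
  then have "AE t in lborel. rep_L2 (c *\<^sub>C abs_L2 (rep_L2 f)) t = c * u t"
    using u(2) unfolding abs_L2_scaleC[OF square_integrable_rep_L2]
    by eventually_elim (simp only:)
  then show "c *\<^sub>C f \<in> schwartz_L2"
    unfolding abs_L2_rep_L2 schwartz_L2_def using schwartz_scale[OF u(1)] by blast
qed

lemma abs_L2_in_schwartz_L2:
  assumes "schwartz u" "square_integrable u"
  shows "abs_L2 u \<in> schwartz_L2"
  unfolding schwartz_L2_def using assms(1) rep_L2_abs_L2[OF assms(2)] by blast

lemma borel_measurable_box_bump [measurable]: "box_bump m s n \<in> borel_measurable borel"
  unfolding box_bump_def[abs_def]
  by measurable

lemma square_integrable_box_bump:
  assumes "\<And>i. i \<in> Basis \<Longrightarrow> 0 < s \<bullet> i" "1 \<le> n"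
  shows "square_integrable (\<lambda>x. complex_of_real (box_bump m s n x))"
  by (rule square_integrable_AE_dominated[OF _ square_integrable_gaussian[OF assms(1), where m=m]])
     (use box_bump_le_gaussian[OF assms(2), of m s] in \<open>auto simp: box_bump_def\<close>)

lemma AE_not_in_box_boundary:
  fixes a b :: "'a::euclidean_space"
  shows "AE x in lborel. x \<notin> cbox a b - box a b"
proof (rule AE_not_in)
  have "emeasure lborel (box a b) = emeasure lborel (cbox a b)"
    by (simp add: emeasure_lborel_box_eq emeasure_lborel_cbox_eq)
  then show "cbox a b - box a b \<in> null_sets lborel"
    using emeasure_lborel_box_finite[of a b] box_subset_cbox[of a b]
    by (auto simp: null_sets_def emeasure_Diff)
qed

lemma square_integrable_indicator_box:
  assumes "A \<in> sets borel"
  shows "square_integrable (\<lambda>x. indicator (A \<inter> box a b) x)"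
  unfolding square_integrable_def
proof
  have "(\<lambda>x. (cmod (indicator (A \<inter> box a b) x))\<^sup>2) = (indicator (A \<inter> box a b) :: 'a \<Rightarrow> real)"
    by (auto simp: indicator_def)
  moreover have "emeasure lborel (A \<inter> box a b) < \<infinity>"
    using emeasure_mono[of "A \<inter> box a b" "box a b" lborel] emeasure_lborel_box_finite[of a b]
    by (simp add: le_less_trans)
  ultimately show "integrable lborel (\<lambda>x. (cmod (indicator (A \<inter> box a b) x))\<^sup>2)"
    using assms by simp
qed (use assms in simp)

lemma indicator_box_in_closure_schwartz:
  fixes a b :: "'a::euclidean_space"
  shows "abs_L2 (indicator (box a b)) \<in> closure schwartz_L2"
proof (cases "box a b = {}")
  case True
  then have "abs_L2 (indicator (box a b)) = (0 :: 'a L2)"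
    by (simp add: zero_L2_def indicator_def[abs_def])
  then show ?thesis
    using L2.subspace_0[OF complex_subspace_closure[OF subspace_schwartz_L2]] by simp
next
  case False
  then have ab: "a \<bullet> i < b \<bullet> i" if "i \<in> Basis" for i
    using that by (simp add: box_ne_empty)
  define m where "m = (1/2) *\<^sub>R (a + b)"
  define s where "s = (1/2) *\<^sub>R (b - a)"
  have s: "0 < s \<bullet> i" if "i \<in> Basis" for i
    using ab[OF that] by (simp add: s_def inner_diff_left)
  let ?w = "\<lambda>x. complex_of_real (exp (\<Sum>i\<in>Basis. 1 - ((x \<bullet> i - m \<bullet> i) / (s \<bullet> i))\<^sup>2))"
  have "(\<lambda>n. abs_L2 (\<lambda>x. complex_of_real (box_bump m s (Suc n) x))) \<longlonglongrightarrow> abs_L2 (indicator (box a b))"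
  proof (rule tendsto_abs_L2_dominated(2)[where w="?w"])
    show "square_integrable ?w"
      by (rule square_integrable_gaussian[OF s])
    show "AE x in lborel. cmod (complex_of_real (box_bump m s (Suc n) x)) \<le> cmod (?w x)" for n
      using box_bump_le_gaussian[of "Suc n" m s] by (simp add: box_bump_def)
    show "AE x in lborel. (\<lambda>n. complex_of_real (box_bump m s (Suc n) x)) \<longlonglongrightarrow> indicator (box a b) x"
      using AE_not_in_box_boundary[of a b]
    proof eventually_elim
      fix x assume x: "x \<notin> cbox a b - box a b"
      have "(\<lambda>n. box_bump m s n x) \<longlonglongrightarrow> indicator (box a b) x"
      proof (cases "x \<in> box a b")
        case True
        have "\<bar>(x \<bullet> i - m \<bullet> i) / (s \<bullet> i)\<bar> < 1" if i: "i \<in> Basis" for i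
        proof -
          have "a \<bullet> i < x \<bullet> i" "x \<bullet> i < b \<bullet> i"
            using True i by (auto simp: mem_box)
          then have "\<bar>x \<bullet> i - m \<bullet> i\<bar> < s \<bullet> i"
            by (auto simp: m_def s_def inner_diff_left inner_add_left abs_less_iff field_simps)
          then show ?thesis
            using s[OF i] by (simp add: abs_divide)
        qed
        then show ?thesis
          using tendsto_box_bump_inside[of x m s] True by simp
      next
        case False
        then obtain i where i: "i \<in> Basis" "x \<bullet> i < a \<bullet> i \<or> b \<bullet> i < x \<bullet> i"
          using x by (auto simp: mem_box not_le)
        have "s \<bullet> i = (b \<bullet> i - a \<bullet> i) / 2" "m \<bullet> i = (a \<bullet> i + b \<bullet> i) / 2"
          by (simp_all add: m_def s_def inner_diff_left inner_add_left)
        then have "s \<bullet> i < \<bar>x \<bullet> i - m \<bullet> i\<bar>"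
          using i(2) ab[OF i(1)] abs_ge_self[of "x \<bullet> i - m \<bullet> i"]
            abs_ge_minus_self[of "x \<bullet> i - m \<bullet> i"]
          by (auto simp: field_simps)
        then have "1 < \<bar>(x \<bullet> i - m \<bullet> i) / (s \<bullet> i)\<bar>"
          using s[OF i(1)] by (simp add: abs_divide)
        then show ?thesis
          using tendsto_box_bump_outside[OF i(1)] False by simp
      qed
      then have "(\<lambda>n. box_bump m s (Suc n) x) \<longlonglongrightarrow> indicator (box a b) x"
        by (rule LIMSEQ_Suc)
      then have "(\<lambda>n. complex_of_real (box_bump m s (Suc n) x)) \<longlonglongrightarrow> complex_of_real (indicator (box a b) x)"
        by (rule tendsto_of_real)
      then show "(\<lambda>n. complex_of_real (box_bump m s (Suc n) x)) \<longlonglongrightarrow> indicator (box a b) x"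
        by (simp add: indicator_def of_bool_def split: if_splits)
    qed
  qed auto
  moreover have "abs_L2 (\<lambda>x. complex_of_real (box_bump m s (Suc n) x)) \<in> schwartz_L2" for n
    by (intro abs_L2_in_schwartz_L2 schwartz_box_bump square_integrable_box_bump s) auto
  ultimately show ?thesis
    by (rule in_closure_of_tendsto[rotated])
qed

text \<open>The sets \<open>A\<close> with this property form a Dynkin system, and boxes are stable under intersection. The fixed
  box keeps all the indicator functions square integrable, so that complements and countable unions make
  sense in \<open>L\<^sup>2\<close>.\<close>

lemma indicator_in_closure_schwartz:
  fixes A :: "'a::euclidean_space set"
  assumes "A \<in> sets borel"
  shows "abs_L2 (indicator (A \<inter> box c d)) \<in> closure schwartz_L2"
proof -
  note sub = complex_subspace_closure[OF subspace_schwartz_L2]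
  have sigma: "sets (borel :: 'a measure) = sigma_sets UNIV (range (\<lambda>(a, b). box a b))"
    unfolding borel_eq_box by simp
  have Int: "Int_stable (range (\<lambda>(a, b). box a b :: 'a set))"
    unfolding Int_stable_def by (auto simp: box_Int_box)
  have box_Pow: "range (\<lambda>(a, b). box a b :: 'a set) \<subseteq> Pow UNIV"
    by simp
  have "A \<in> sigma_sets UNIV (range (\<lambda>(a, b). box a b))"
    using assms sigma by simp
  with Int box_Pow show ?thesis
  proof (induction rule: sigma_sets_induct_disjoint)
    case (basic A)
    then obtain a b where "A = box a b" by auto
    then show ?case
      by (simp add: box_Int_box indicator_box_in_closure_schwartz)
  next
    case empty
    then show ?case
      using L2.subspace_0[OF sub] by (simp add: zero_L2_def)
  next
    case (compl A)
    then have A: "A \<in> sets borel" by (simp add: sigma)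
    have "(\<lambda>x. indicator (UNIV \<inter> box c d) x - indicator (A \<inter> box c d) x :: complex)
        = indicator ((UNIV - A) \<inter> box c d)"
      by (auto simp: indicator_def fun_eq_iff)
    then have "abs_L2 (indicator ((UNIV - A) \<inter> box c d))
        = abs_L2 (indicator (UNIV \<inter> box c d)) - abs_L2 (indicator (A \<inter> box c d))"
      using abs_L2_diff[OF square_integrable_indicator_box square_integrable_indicator_box, of UNIV A c d c d] A
      by simp
    then show ?case
      using L2.subspace_diff[OF sub _ compl.IH] indicator_box_in_closure_schwartz[of c d] by simp
  next
    case (union A)
    then have A: "A n \<in> sets borel" for n
      using sigma by auto
    then have A': "(\<Union>i<n. A i) \<in> sets borel" for n :: nat
      by (intro sets.finite_UN) auto
    have "abs_L2 (indicator ((\<Union>i<n. A i) \<inter> box c d)) \<in> closure schwartz_L2" for n :: nat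
    proof (induction n)
      case 0
      show ?case
        using L2.subspace_0[OF sub] by (simp add: zero_L2_def)
    next
      case (Suc n)
      have "A n \<inter> (\<Union>i<n. A i) = {}"
      proof -
        have "A n \<inter> A i = {}" if "i < n" for i
          using disjoint_family_onD[OF union(1), of n i] that by simp
        then show ?thesis by blast
      qed
      then have "(\<lambda>x. indicator ((\<Union>i<n. A i) \<inter> box c d) x + indicator (A n \<inter> box c d) x :: complex)
          = indicator ((\<Union>i<Suc n. A i) \<inter> box c d)"
        by (auto simp: indicator_def fun_eq_iff lessThan_Suc)
      then have "abs_L2 (indicator ((\<Union>i<Suc n. A i) \<inter> box c d))
          = abs_L2 (indicator ((\<Union>i<n. A i) \<inter> box c d)) + abs_L2 (indicator (A n \<inter> box c d))"
        using abs_L2_add[OF square_integrable_indicator_box[OF A'] square_integrable_indicator_box[OF A]]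
        by simp
      then show ?case
        using L2.subspace_add[OF sub Suc.IH union(3)] by simp
    qed
    moreover have "(\<lambda>n. abs_L2 (indicator ((\<Union>i<n. A i) \<inter> box c d))) \<longlonglongrightarrow> abs_L2 (indicator ((\<Union>i. A i) \<inter> box c d))"
    proof (rule tendsto_abs_L2_dominated(2)[where w="indicator (UNIV \<inter> box c d)"])
      show "square_integrable (indicator (UNIV \<inter> box c d) :: 'a \<Rightarrow> complex)"
        by (rule square_integrable_indicator_box) simp
      have "(\<lambda>n. indicator ((\<Union>i<n. A i) \<inter> box c d) x :: complex) \<longlonglongrightarrow> indicator ((\<Union>i. A i) \<inter> box c d) x" for x
      proof (cases "\<exists>k. x \<in> A k")
        case True
        then obtain k where "x \<in> A k" by blast
        then have "\<forall>\<^sub>F n in sequentially. indicator ((\<Union>i<n. A i) \<inter> box c d) x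
            = (indicator ((\<Union>i. A i) \<inter> box c d) x :: complex)"
          by (intro eventually_sequentiallyI[of "Suc k"]) (auto simp: indicator_def)
        then show ?thesis by (rule tendsto_eventually)
      qed (auto simp: indicator_def)
      then show "AE x in lborel. (\<lambda>n. indicator ((\<Union>i<n. A i) \<inter> box c d) x :: complex) \<longlonglongrightarrow> indicator ((\<Union>i. A i) \<inter> box c d) x"
        by simp
    qed (use A A' in \<open>auto simp: indicator_def\<close>)
    ultimately have "abs_L2 (indicator ((\<Union>i. A i) \<inter> box c d)) \<in> closure (closure schwartz_L2)"
      by (rule in_closure_of_tendsto)
    then show ?case
      by (simp only: closure_closure)
  qed
qed

lemma simple_function_in_closure_schwartz:
  fixes s :: "'a::euclidean_space \<Rightarrow> complex"
  assumes s: "simple_function lborel s"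
  shows "abs_L2 (\<lambda>x. s x * indicator (box c d) x) \<in> closure schwartz_L2"
proof -
  note sub = complex_subspace_closure[OF subspace_schwartz_L2]
  have meas: "s -` {y} \<in> sets borel" for y
    using simple_functionD(2)[OF s, of "{y}"] by simp
  have fin: "finite (range s)"
    using simple_functionD(1)[OF s] by simp
  let ?t = "\<lambda>Y x. \<Sum>y\<in>Y. y * indicator (s -` {y} \<inter> box c d) x"
  have "square_integrable (?t Y) \<and> abs_L2 (?t Y) \<in> closure schwartz_L2" if "finite Y" for Y
    using that
  proof (induction Y)
    case empty
    then show ?case
      using L2.subspace_0[OF sub] by (simp add: zero_L2_def square_integrable_zero)
  next
    case (insert y Y)
    let ?i = "indicator (s -` {y} \<inter> box c d)"
    have i: "square_integrable ?i"
      by (rule square_integrable_indicator_box[OF meas])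
    have eq: "?t (insert y Y) = (\<lambda>x. y * ?i x + ?t Y x)"
      by (rule ext) (rule sum.insert[OF insert.hyps])
    have "abs_L2 (?t (insert y Y)) = y *\<^sub>C abs_L2 ?i + abs_L2 (?t Y)"
      unfolding eq abs_L2_scaleC[OF i]
      by (rule abs_L2_add[OF square_integrable_scale[OF i] conjunct1[OF insert.IH], symmetric])
    moreover have "y *\<^sub>C abs_L2 ?i + abs_L2 (?t Y) \<in> closure schwartz_L2"
      by (intro L2.subspace_add[OF sub] L2.subspace_scale[OF sub] indicator_in_closure_schwartz meas
          conjunct2[OF insert.IH])
    moreover have "square_integrable (?t (insert y Y))"
      unfolding eq by (intro square_integrable_add square_integrable_scale i conjunct1[OF insert.IH])
    ultimately show ?case by simp
  qed
  then have "abs_L2 (?t (range s)) \<in> closure schwartz_L2"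
    using fin by blast
  moreover have "?t (range s) = (\<lambda>x. s x * indicator (box c d) x)"
  proof
    fix x
    have "?t (range s) x = (\<Sum>y\<in>range s. if y = s x then s x * indicator (box c d) x else 0)"
      by (intro sum.cong) (auto simp: indicator_def)
    then show "?t (range s) x = s x * indicator (box c d) x"
      using fin by simp
  qed
  ultimately show ?thesis by (simp only:)
qed

text \<open>Approximate \<open>f\<close> by simple functions bounded by \<open>2 \<bar>f\<bar>\<close>, and cut these off to growing boxes.\<close>

theorem closure_schwartz_L2: "closure schwartz_L2 = (UNIV :: 'a::euclidean_space L2 set)"
proof -
  have "f \<in> closure schwartz_L2" for f :: "'a L2"
  proof -
    let ?f = "rep_L2 f"
    have f: "square_integrable ?f" and f_meas [measurable]: "?f \<in> borel_measurable borel"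
      using square_integrable_rep_L2[of f] by (auto simp: square_integrable_def)
    obtain s where s: "\<And>i. simple_function lborel (s i)" "\<And>x. (\<lambda>i. s i x) \<longlonglongrightarrow> ?f x"
      "\<And>i x. cmod (s i x) \<le> 2 * cmod (?f x)"
      using borel_measurable_implies_sequence_metric[of ?f lborel 0] by (auto simp: dist_norm)
    have [measurable]: "s i \<in> borel_measurable borel" for i
      using borel_measurable_simple_function[OF s(1)] by simp
    let ?B = "\<lambda>i::nat. box (- (real i *\<^sub>R One)) (real i *\<^sub>R One) :: 'a set"
    have "(\<lambda>i. abs_L2 (\<lambda>x. s i x * indicator (?B i) x)) \<longlonglongrightarrow> abs_L2 ?f"
    proof (rule tendsto_abs_L2_dominated(2)[where w="\<lambda>x. 2 * ?f x"])
      show "AE x in lborel. cmod (s i x * indicator (?B i) x) \<le> cmod (2 * ?f x)" for i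
        using s(3)[of i] by (auto simp: indicator_def norm_mult)
      have "(\<lambda>i. s i x * indicator (?B i) x) \<longlonglongrightarrow> ?f x" for x
      proof -
        obtain k where k: "x \<in> ?B k"
          using UN_box_eq_UNIV by blast
        have "\<forall>\<^sub>F i in sequentially. s i x = s i x * indicator (?B i) x"
        proof (rule eventually_sequentiallyI[of k])
          fix i assume "k \<le> i"
          then have "?B k \<subseteq> ?B i"
            by (intro subset_box_imp) (auto simp: inner_One_Basis)
          then show "s i x = s i x * indicator (?B i) x"
            using k by (auto simp: indicator_def)
        qed
        then show ?thesis
          using s(2)[of x] by (rule Lim_transform_eventually[rotated])
      qed
      then show "AE x in lborel. (\<lambda>i. s i x * indicator (?B i) x) \<longlonglongrightarrow> ?f x"
        by simp
      show "square_integrable (\<lambda>x. 2 * ?f x)"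
        by (rule square_integrable_scale[OF f])
    qed auto
    then have "f \<in> closure (closure schwartz_L2)"
      unfolding abs_L2_rep_L2
      by (rule in_closure_of_tendsto[rotated]) (rule simple_function_in_closure_schwartz[OF s(1)])
    then show ?thesis by simp
  qed
  then show ?thesis by blast
qed


section \<open>The Cohen integral as a matrix coefficient\<close>

lemma schwartz_normalized_exists: "\<exists>\<eta> :: 'b::euclidean_space \<Rightarrow> complex. schwartz \<eta> \<and> \<eta> 0 = 1"
proof (intro exI conjI)
  show "schwartz (\<lambda>x::'b. complex_of_real (box_bump 0 One 1 x))"
    by (rule schwartz_box_bump) (simp_all add: inner_One_Basis)
qed (simp add: box_bump_def)

text \<open>Two pairings are limits of the same expression, for any one normalised cutoff; the Gaussian is such a cutoff.\<close>

lemma pairing_eq: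
  assumes "has_pairing F \<phi> v"
  shows "pairing F \<phi> = v"
  unfolding pairing_def
proof (rule the_equality[where P="has_pairing F \<phi>", OF assms])
  fix w assume w: "has_pairing F \<phi> w"
  obtain \<eta> :: "'a \<Rightarrow> complex" where "schwartz \<eta> \<and> \<eta> 0 = 1"
    using schwartz_normalized_exists by blast
  then have "((\<lambda>\<epsilon>. F (\<lambda>z. \<eta> (\<epsilon> *\<^sub>R z) * \<phi> z)) \<longlongrightarrow> v) (at_right 0)"
    "((\<lambda>\<epsilon>. F (\<lambda>z. \<eta> (\<epsilon> *\<^sub>R z) * \<phi> z)) \<longlongrightarrow> w) (at_right 0)"
    using assms w unfolding has_pairing_def by blast+
  then have "v = w"
    by (rule tendsto_unique[OF trivial_limit_at_right_real])
  then show "w = v" ..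
qed

lemma schwartz_L2_nontrivial: "\<exists>h \<in> schwartz_L2. h \<noteq> (0 :: 'a::euclidean_space L2)"
proof
  let ?u = "\<lambda>x::'a. complex_of_real (box_bump 0 One 1 x)"
  have u: "square_integrable ?u" "schwartz ?u"
    by (rule square_integrable_box_bump schwartz_box_bump; simp add: inner_One_Basis)+
  then show "abs_L2 ?u \<in> schwartz_L2"
    by (intro abs_L2_in_schwartz_L2)
  show "abs_L2 ?u \<noteq> 0"
  proof
    assume "abs_L2 ?u = 0"
    then have "AE x in lborel. rep_L2 (abs_L2 (\<lambda>_. 0)) x = ?u x"
      using rep_L2_abs_L2[OF u(1)] by (simp only: zero_L2_def)
    moreover have "AE x::'a in lborel. rep_L2 (abs_L2 (\<lambda>_. 0)) x = (0 :: complex)"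
      by (rule rep_L2_abs_L2[OF square_integrable_zero])
    ultimately have "AE x::'a in lborel. False"
      by eventually_elim (simp add: box_bump_def)
    then have "emeasure lborel (UNIV :: 'a set) = 0"
      by (simp add: AE_iff_measurable[of "UNIV :: 'a set"])
    then show False by simp
  qed
qed

text \<open>The limit that defines \<^const>\<open>has_cohen_integral\<close> excludes the point \<open>(f, g)\<close> itself. If \<open>f\<close> and \<open>g\<close> are test
  functions, density therefore says nothing, and \<open>(f, g)\<close> is approached along \<open>(f + h / n, g)\<close> instead.\<close>

lemma schwartz_pairs_islimpt:
  fixes f g :: "'a::euclidean_space L2"
  shows "(f, g) islimpt schwartz_L2 \<times> schwartz_L2"
proof -
  obtain h :: "'a L2" where h: "h \<in> schwartz_L2" "h \<noteq> 0"
    using schwartz_L2_nontrivial by blast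
  have "closure (schwartz_L2 \<times> schwartz_L2) = (UNIV :: ('a L2 \<times> 'a L2) set)"
    by (simp add: closure_Times closure_schwartz_L2)
  then consider "(f, g) \<in> schwartz_L2 \<times> schwartz_L2" | "(f, g) islimpt schwartz_L2 \<times> schwartz_L2"
    unfolding closure_def by blast
  then show ?thesis
  proof cases
    case 1
    define X where "X n = (f + (1 / real (Suc n)) *\<^sub>R h, g)" for n
    have "(1 / real (Suc n)) *\<^sub>R h \<in> schwartz_L2" for n
      unfolding scaleR_L2_eq_scaleC by (rule L2.subspace_scale[OF subspace_schwartz_L2 h(1)])
    then have "X n \<in> schwartz_L2 \<times> schwartz_L2 - {(f, g)}" for n
      using 1 h(2) L2.subspace_add[OF subspace_schwartz_L2, of f] by (simp add: X_def del: of_nat_Suc)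
    moreover have "X \<longlonglongrightarrow> (f + 0 *\<^sub>R h, g)"
      unfolding X_def by (intro tendsto_intros LIMSEQ_Suc[OF lim_1_over_n])
    ultimately show ?thesis
      unfolding islimpt_sequential by (intro exI[of _ X]) auto
  qed
qed

text \<open>For test functions the pairing is \<open>\<langle>T u, w\<rangle>\<close>, which is continuous in \<open>(u, w)\<close>. The limit exists by continuity
  and is unique by density of the test functions.\<close>

lemma has_cohen_integral_iff:
  fixes f g :: "'a::euclidean_space L2"
  assumes T: "is_localization_op F S T"
  shows "has_cohen_integral F S f g v \<longleftrightarrow> v = cinner (T f) g"
proof -
  have "bounded_linear T"
    using T by (simp add: is_localization_op_def bounded_clinear_def)
  then have "((\<lambda>(u, w). cinner (T u) w) \<longlongrightarrow> cinner (T f) g) (at (f, g) within schwartz_L2 \<times> schwartz_L2)"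
    unfolding case_prod_beta
    by (intro bounded_bilinear.tendsto[OF bounded_bilinear_cinner] bounded_linear.tendsto[of T])
       (auto intro!: tendsto_eq_intros)
  also have "?this \<longleftrightarrow> has_cohen_integral F S f g (cinner (T f) g)"
    unfolding has_cohen_integral_def
  proof (rule Lim_cong_within)
    fix x :: "'a L2 \<times> 'a L2" assume "x \<in> schwartz_L2 \<times> schwartz_L2"
    then have "pairing F (cohen_class S (fst x) (snd x)) = cinner (T (fst x)) (snd x)"
      using T by (intro pairing_eq) (auto simp: is_localization_op_def)
    then show "(case x of (u, w) \<Rightarrow> cinner (T u) w) = (case x of (u, w) \<Rightarrow> pairing F (cohen_class S u w))"
      by (simp add: case_prod_beta)
  qed auto
  finally have lim: "has_cohen_integral F S f g (cinner (T f) g)" .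
  have "at (f, g) within schwartz_L2 \<times> schwartz_L2 \<noteq> bot"
    using schwartz_pairs_islimpt[of f g] by (simp add: trivial_limit_within)
  then have "v = cinner (T f) g" if "has_cohen_integral F S f g v"
    using that lim unfolding has_cohen_integral_def by (rule tendsto_unique)
  with lim show ?thesis by blast
qed

theorem proposition5p1:
  fixes S T :: "(real ^ 'd) L2 \<Rightarrow> (real ^ 'd) L2"
    and F :: "((real ^ 'd) \<times> (real ^ 'd) \<Rightarrow> complex) \<Rightarrow> complex"
    and \<psi> :: "nat ^ 'd \<Rightarrow> (real ^ 'd) L2"
  assumes "bounded_clinear S"
    and "tempered_distribution F"
    and "is_localization_op F S T"
    and "compact_operator T"
  shows "((\<exists>\<mu>. eigenfunctions T \<psi> \<mu>) \<longleftrightarrow>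
            orthonormal_basis UNIV \<psi> \<and>
            (\<exists>c. \<forall>n m. has_cohen_integral F S (\<psi> n) (\<psi> m) (if n = m then c n else 0)))
       \<and> (\<forall>\<mu> c. eigenfunctions T \<psi> \<mu> \<and>
            (\<forall>n m. has_cohen_integral F S (\<psi> n) (\<psi> m) (if n = m then c n else 0)) \<longrightarrow> \<mu> = c)"
proof -
  have T: "bounded_clinear T"
    using assms(3) by (simp add: is_localization_op_def)
  have matrix: "(\<forall>n m. has_cohen_integral F S (\<psi> n) (\<psi> m) (if n = m then c n else 0)) \<longleftrightarrow>
      (\<forall>n m. cinner (T (\<psi> n)) (\<psi> m) = (if n = m then c n else 0))" for c
    unfolding has_cohen_integral_iff[OF assms(3)] by (metis (full_types))
  show ?thesis
    unfolding matrix
  proof (intro conjI iffI allI impI; (elim exE conjE)?)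
    fix \<mu> assume eig: "eigenfunctions T \<psi> \<mu>"
    show "orthonormal_basis UNIV \<psi>"
      by (rule orthonormal_basis_of_eigenfunctions[OF eig T])
    show "\<exists>c. \<forall>n m. cinner (T (\<psi> n)) (\<psi> m) = (if n = m then c n else 0)"
      using eigenfunctions_matrix[OF eig] by blast
  next
    fix c assume "orthonormal_basis UNIV \<psi>"
      "\<forall>n m. cinner (T (\<psi> n)) (\<psi> m) = (if n = m then c n else 0)"
    then show "\<exists>\<mu>. eigenfunctions T \<psi> \<mu>"
      using eigenfunctions_of_diagonal_matrix[OF _ T] by blast
  next
    fix \<mu> c assume "eigenfunctions T \<psi> \<mu>"
      "\<forall>n m. cinner (T (\<psi> n)) (\<psi> m) = (if n = m then c n else 0)"
    then show "\<mu> = c"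
      using eigenfunctions_matrix[of T \<psi> \<mu>] by (metis (full_types) ext)
  qed
qed

end
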